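(* Let $P$ be a connected finite $\Gamma$-colored minuscule poset and assume $\Gamma$ is multiply laced. Then $P$ has type $B$ or type $C$.
   Context: A Dynkin diagram $\Gamma$: finite set of colors with integers $\theta_{ab}$, $\theta_{aa}=2$, $\theta_{ab}\le0$ ($a\ne b$), $\theta_{ab}=0\iff\theta_{ba}=0$; $a\sim b$ if $a\ne b$ and $\theta_{ab}<0$; simply laced if all $\theta_{ab}\in\{-1,0,2\}$, multiply laced otherwise. $\Gamma$-colored poset: poset $P$ with surjective $\kappa:P\to\Gamma$; isomorphism of colored posets: poset isomorphism $\pi$ and $\theta$-preserving bijection $\gamma$ of diagrams with $\kappa_2\pi=\gamma\kappa_1$. Consecutive elements of color $a$: $x<y$ of color $a$, no color-$a$ element in $(x,y)$. $U(x,P)=\{y>x:\kappa(y)\sim\kappa(x)\}$, $L(x,P)=\{y<x:\kappa(y)\sim\kappa(x)\}$. $P$ is $\Gamma$-colored minuscule if locally finite and: (EC) equal colors comparable; (NA) neighbors (one covers the other) have adjacent colors; (AC) adjacent colors comparable; (ICE2) consecutive $x<y$ of color $a$ satisfy $\sum_{z\in(x,y)}-\theta_{\kappa(z),a}=2$; (UCB1) for maximal $x$ of color $a$, $U(x,P)$ finite and $\sum_{y\in U(x,P)}-\theta_{\kappa(y),a}\le1$; (LCB1) for minimal $x$ of color $a$, $L(x,P)$ finite and $\sum_{y\in L(x,P)}-\theta_{\kappa(y),a}\le1$. Type $B$ ($n\ge2$): $\Gamma$ has nodes $c_0,\dots,c_{n-1}$ with $\theta_{c_0c_1}=-1$, $\theta_{c_1c_0}=-2$,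 $\theta_{c_sc_{s+1}}=\theta_{c_{s+1}c_s}=-1$ for $1\le s\le n-2$, other pairs distant; the poset is $\{(u,v)\in\mathbb Z^2:0\le u\le v\le n-1\}$ with $(u,v)\le(u',v')$ iff $u\ge u'$ and $v\ge v'$, colored $\kappa(u,v)=c_{v-u}$. Type $C$ ($n\ge3$): $\Gamma$ has nodes $c_1,\dots,c_n$ with $\theta_{c_sc_{s+1}}=\theta_{c_{s+1}c_s}=-1$ for $1\le s\le n-2$, $\theta_{c_{n-1}c_n}=-1$, $\theta_{c_nc_{n-1}}=-2$, others distant; the poset is a chain of $2n-1$ elements colored from top to bottom $c_1,\dots,c_{n-1},c_n,c_{n-1},\dots,c_1$. $P$ has type $B$ (resp. $C$) if it is isomorphic to the type $B$ (resp. $C$) poset for some allowed $n$. *)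

theory Defs
  imports Main
begin

locale dynkin_diagram =
  fixes \<Gamma> :: "'c set" and \<theta> :: "'c \<Rightarrow> 'c \<Rightarrow> int"
  assumes finite_colors: "finite \<Gamma>"
    and theta_diag: "a \<in> \<Gamma> \<Longrightarrow> \<theta> a a = 2"
    and theta_nonpos: "\<lbrakk>a \<in> \<Gamma>; b \<in> \<Gamma>; a \<noteq> b\<rbrakk> \<Longrightarrow> \<theta> a b \<le> 0"
    and theta_zero_iff: "\<lbrakk>a \<in> \<Gamma>; b \<in> \<Gamma>\<rbrakk> \<Longrightarrow> \<theta> a b = 0 \<longleftrightarrow> \<theta> b a = 0"

definition adjacent :: "('c \<Rightarrow> 'c \<Rightarrow> int) \<Rightarrow> 'c \<Rightarrow> 'c \<Rightarrow> bool" where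
  "adjacent \<theta> a b \<longleftrightarrow> a \<noteq> b \<and> \<theta> a b < 0"

definition simply_laced :: "'c set \<Rightarrow> ('c \<Rightarrow> 'c \<Rightarrow> int) \<Rightarrow> bool" where
  "simply_laced \<Gamma> \<theta> \<longleftrightarrow> (\<forall>a\<in>\<Gamma>. \<forall>b\<in>\<Gamma>. \<theta> a b \<in> {-1, 0, 2})"

abbreviation multiply_laced :: "'c set \<Rightarrow> ('c \<Rightarrow> 'c \<Rightarrow> int) \<Rightarrow> bool" where
  "multiply_laced \<Gamma> \<theta> \<equiv> \<not> simply_laced \<Gamma> \<theta>"

(* A poset is a carrier set P with a relation r such that partial_order_on P r;
   (x, y) \<in> r stands for x \<le> y, and all elements related by r lie in P. *)

definition strict_below :: "('p \<times> 'p) set \<Rightarrow> 'p \<Rightarrow> 'p \<Rightarrow> bool" where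
  "strict_below r x y \<longleftrightarrow> (x, y) \<in> r \<and> x \<noteq> y"

definition comparable :: "('p \<times> 'p) set \<Rightarrow> 'p \<Rightarrow> 'p \<Rightarrow> bool" where
  "comparable r x y \<longleftrightarrow> (x, y) \<in> r \<or> (y, x) \<in> r"

definition closed_interval :: "('p \<times> 'p) set \<Rightarrow> 'p \<Rightarrow> 'p \<Rightarrow> 'p set" where
  "closed_interval r x y = {z. (x, z) \<in> r \<and> (z, y) \<in> r}"

definition open_interval :: "('p \<times> 'p) set \<Rightarrow> 'p \<Rightarrow> 'p \<Rightarrow> 'p set" where
  "open_interval r x y = {z. strict_below r x z \<and> strict_below r z y}"

definition cover_rel :: "('p \<times> 'p) set \<Rightarrow> ('p \<times> 'p) set" where
  "cover_rel r = {(x, y). strict_below r x y \<and> open_interval r x y = {}}"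

(* Connectedness of the Hasse diagram as an undirected graph. *)
definition connected_poset :: "'p set \<Rightarrow> ('p \<times> 'p) set \<Rightarrow> bool" where
  "connected_poset P r \<longleftrightarrow> (\<forall>x\<in>P. \<forall>y\<in>P. (x, y) \<in> (cover_rel r \<union> (cover_rel r)\<inverse>)\<^sup>*)"

locale colored_poset = dynkin_diagram \<Gamma> \<theta>
  for \<Gamma> :: "'c set" and \<theta> :: "'c \<Rightarrow> 'c \<Rightarrow> int" +
  fixes P :: "'p set" and r :: "('p \<times> 'p) set" and \<kappa> :: "'p \<Rightarrow> 'c"
  assumes poset: "partial_order_on P r"
    and surj_coloring: "\<kappa> ` P = \<Gamma>"

definition consecutive :: "('p \<times> 'p) set \<Rightarrow> ('p \<Rightarrow> 'c) \<Rightarrow> 'c \<Rightarrow> 'p \<Rightarrow> 'p \<Rightarrow> bool" where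
  "consecutive r \<kappa> a x y \<longleftrightarrow> strict_below r x y \<and> \<kappa> x = a \<and> \<kappa> y = a
     \<and> (\<forall>z\<in>open_interval r x y. \<kappa> z \<noteq> a)"

definition upper_adj :: "('c \<Rightarrow> 'c \<Rightarrow> int) \<Rightarrow> ('p \<times> 'p) set \<Rightarrow> ('p \<Rightarrow> 'c) \<Rightarrow> 'p \<Rightarrow> 'p set" where
  "upper_adj \<theta> r \<kappa> x = {y. strict_below r x y \<and> adjacent \<theta> (\<kappa> y) (\<kappa> x)}"

definition lower_adj :: "('c \<Rightarrow> 'c \<Rightarrow> int) \<Rightarrow> ('p \<times> 'p) set \<Rightarrow> ('p \<Rightarrow> 'c) \<Rightarrow> 'p \<Rightarrow> 'p set" where
  "lower_adj \<theta> r \<kappa> x = {y. strict_below r y x \<and> adjacent \<theta> (\<kappa> y) (\<kappa> x)}"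

(* Maximality and minimality are within the set of elements of color a, not within P. *)

definition maximal_of_color ::
    "'p set \<Rightarrow> ('p \<times> 'p) set \<Rightarrow> ('p \<Rightarrow> 'c) \<Rightarrow> 'c \<Rightarrow> 'p \<Rightarrow> bool" where
  "maximal_of_color P r \<kappa> a x \<longleftrightarrow>
     x \<in> P \<and> \<kappa> x = a \<and> \<not> (\<exists>y\<in>P. \<kappa> y = a \<and> strict_below r x y)"

definition minimal_of_color ::
    "'p set \<Rightarrow> ('p \<times> 'p) set \<Rightarrow> ('p \<Rightarrow> 'c) \<Rightarrow> 'c \<Rightarrow> 'p \<Rightarrow> bool" where
  "minimal_of_color P r \<kappa> a x \<longleftrightarrow>
     x \<in> P \<and> \<kappa> x = a \<and> \<not> (\<exists>y\<in>P. \<kappa> y = a \<and> strict_below r y x)"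

locale minuscule_poset = colored_poset \<Gamma> \<theta> P r \<kappa>
  for \<Gamma> :: "'c set" and \<theta> :: "'c \<Rightarrow> 'c \<Rightarrow> int"
    and P :: "'p set" and r :: "('p \<times> 'p) set" and \<kappa> :: "'p \<Rightarrow> 'c" +
  assumes locally_finite: "\<lbrakk>x \<in> P; y \<in> P\<rbrakk> \<Longrightarrow> finite (closed_interval r x y)"
    and EC: "\<lbrakk>x \<in> P; y \<in> P; \<kappa> x = \<kappa> y\<rbrakk> \<Longrightarrow> comparable r x y"
    and NA: "(x, y) \<in> cover_rel r \<Longrightarrow> adjacent \<theta> (\<kappa> x) (\<kappa> y)"
    and AC: "\<lbrakk>x \<in> P; y \<in> P; adjacent \<theta> (\<kappa> x) (\<kappa> y)\<rbrakk> \<Longrightarrow> comparable r x y"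
    and ICE2: "\<lbrakk>a \<in> \<Gamma>; consecutive r \<kappa> a x y\<rbrakk> \<Longrightarrow> (\<Sum>z\<in>open_interval r x y. - \<theta> (\<kappa> z) a) = 2"
    and UCB1: "\<lbrakk>a \<in> \<Gamma>; maximal_of_color P r \<kappa> a x\<rbrakk> \<Longrightarrow>
      finite (upper_adj \<theta> r \<kappa> x) \<and> (\<Sum>y\<in>upper_adj \<theta> r \<kappa> x. - \<theta> (\<kappa> y) a) \<le> 1"
    and LCB1: "\<lbrakk>a \<in> \<Gamma>; minimal_of_color P r \<kappa> a x\<rbrakk> \<Longrightarrow>
      finite (lower_adj \<theta> r \<kappa> x) \<and> (\<Sum>y\<in>lower_adj \<theta> r \<kappa> x. - \<theta> (\<kappa> y) a) \<le> 1"

definition colored_poset_iso ::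
    "'c set \<Rightarrow> ('c \<Rightarrow> 'c \<Rightarrow> int) \<Rightarrow> 'p set \<Rightarrow> ('p \<times> 'p) set \<Rightarrow> ('p \<Rightarrow> 'c) \<Rightarrow>
     'd set \<Rightarrow> ('d \<Rightarrow> 'd \<Rightarrow> int) \<Rightarrow> 'q set \<Rightarrow> ('q \<times> 'q) set \<Rightarrow> ('q \<Rightarrow> 'd) \<Rightarrow>
     ('p \<Rightarrow> 'q) \<Rightarrow> ('c \<Rightarrow> 'd) \<Rightarrow> bool" where
  "colored_poset_iso \<Gamma>1 \<theta>1 P1 r1 \<kappa>1 \<Gamma>2 \<theta>2 P2 r2 \<kappa>2 \<pi> \<gamma> \<longleftrightarrow>
     bij_betw \<pi> P1 P2 \<and> (\<forall>x\<in>P1. \<forall>y\<in>P1. (x, y) \<in> r1 \<longleftrightarrow> (\<pi> x, \<pi> y) \<in> r2) \<and>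
     bij_betw \<gamma> \<Gamma>1 \<Gamma>2 \<and> (\<forall>a\<in>\<Gamma>1. \<forall>b\<in>\<Gamma>1. \<theta>2 (\<gamma> a) (\<gamma> b) = \<theta>1 a b) \<and>
     (\<forall>x\<in>P1. \<kappa>2 (\<pi> x) = \<gamma> (\<kappa>1 x))"

(* In the models below the color c_s is represented by the natural number s. *)

definition B_colors :: "nat \<Rightarrow> nat set" where
  "B_colors n = {0..<n}"

definition B_theta :: "nat \<Rightarrow> nat \<Rightarrow> int" where
  "B_theta s t = (if s = t then 2
     else if s = 1 \<and> t = 0 then -2
     else if t = Suc s \<or> s = Suc t then -1
     else 0)"

definition B_carrier :: "nat \<Rightarrow> (int \<times> int) set" where
  "B_carrier n = {(u, v). 0 \<le> u \<and> u \<le> v \<and> v \<le> int n - 1}"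

definition B_order :: "nat \<Rightarrow> ((int \<times> int) \<times> (int \<times> int)) set" where
  "B_order n = {((u, v), (u', v')).
     (u, v) \<in> B_carrier n \<and> (u', v') \<in> B_carrier n \<and> u \<ge> u' \<and> v \<ge> v'}"

definition B_coloring :: "int \<times> int \<Rightarrow> nat" where
  "B_coloring = (\<lambda>(u, v). nat (v - u))"

definition C_colors :: "nat \<Rightarrow> nat set" where
  "C_colors n = {1..n}"

definition C_theta :: "nat \<Rightarrow> nat \<Rightarrow> nat \<Rightarrow> int" where
  "C_theta n s t = (if s = t then 2
     else if s = n \<and> t = n - 1 then -2
     else if t = Suc s \<or> s = Suc t then -1
     else 0)"

(* The i-th element of the chain from the top is represented by i, so the order on the
   chain is the reverse of the numerical one. *)

definition C_carrier :: "nat \<Rightarrow> nat set" where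
  "C_carrier n = {1..2 * n - 1}"

definition C_order :: "nat \<Rightarrow> (nat \<times> nat) set" where
  "C_order n = {(i, j). i \<in> C_carrier n \<and> j \<in> C_carrier n \<and> i \<ge> j}"

definition C_coloring :: "nat \<Rightarrow> nat \<Rightarrow> nat" where
  "C_coloring n i = (if i \<le> n then i else 2 * n - i)"

definition type_B ::
    "'c set \<Rightarrow> ('c \<Rightarrow> 'c \<Rightarrow> int) \<Rightarrow> 'p set \<Rightarrow> ('p \<times> 'p) set \<Rightarrow> ('p \<Rightarrow> 'c) \<Rightarrow> bool" where
  "type_B \<Gamma> \<theta> P r \<kappa> \<longleftrightarrow> (\<exists>n\<ge>2. \<exists>\<pi> \<gamma>. colored_poset_iso \<Gamma> \<theta> P r \<kappa>
     (B_colors n) B_theta (B_carrier n) (B_order n) B_coloring \<pi> \<gamma>)"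

definition type_C ::
    "'c set \<Rightarrow> ('c \<Rightarrow> 'c \<Rightarrow> int) \<Rightarrow> 'p set \<Rightarrow> ('p \<times> 'p) set \<Rightarrow> ('p \<Rightarrow> 'c) \<Rightarrow> bool" where
  "type_C \<Gamma> \<theta> P r \<kappa> \<longleftrightarrow> (\<exists>n\<ge>3. \<exists>\<pi> \<gamma>. colored_poset_iso \<Gamma> \<theta> P r \<kappa>
     (C_colors n) (C_theta n) (C_carrier n) (C_order n) (C_coloring n) \<pi> \<gamma>)"

end

(* A color b with theta b a <= -2 cannot occur above the top or below the bottom element of
   color a (UCB1, LCB1), so by ICE2 it occurs alone inside intervals of consecutive elements
   of color a, and theta b a = -2, theta a b = -1.  A descent shows that every such interval
   contains an element of color b.  Counting neighbors then gives a dichotomy.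
   If b is the only neighbor of a, then consecutive elements of color b alternate with those
   of color a, and this alternation propagates: each color is followed by at most one further
   color, which has one element fewer.  The color and the number of elements of the same color
   above a given element are coordinates that identify the poset with the type B one.
   Otherwise there is one element of color b between two elements of color a, and each
   further color contributes exactly one element above and one below all previous ones, which
   makes the poset the type C chain. *)

theory Submission
  imports Defs
begin

text \<open>Nothing local makes two intervals between consecutive elements of color \<open>a\<close>
  contain the same colors: ICE2 can be met by one neighbor of weight 2 or by any two of weight 1.
  This is why a descent is needed before any counting. What drives the propagation is a budget. UCB1
  and LCB1 leave at most one neighbor above the top and one below the bottom element of a color, and
  ICE2 leaves weight 2 inside each interval. In the interlaced case the earlier color uses up both
  outer places and weight 1 of every interval, so a further color must lie inside, once per
  interval. In the enclosing case the earlier color takes the whole inner weight, so a further color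
  must lie outside, once on each side. Either way a second further color finds no room, so the
  diagram is a path with the double bond at one end.\<close>

lemma int_weights_sum_2:
  fixes f :: "'a \<Rightarrow> int"
  assumes "finite N" and "\<And>z. z \<in> N \<Longrightarrow> 1 \<le> f z" and "sum f N = 2"
  shows "(\<exists>z. N = {z} \<and> f z = 2) \<or> (\<exists>z w. z \<noteq> w \<and> N = {z, w} \<and> f z = 1 \<and> f w = 1)"
proof -
  have "int (card N) \<le> 2"
    using sum_mono[of N "\<lambda>_. 1" f] assms by simp
  moreover have "card N \<noteq> 0"
    using assms by auto
  ultimately consider "card N = 1" | "card N = 2"
    by linarith
  then show ?thesis
  proof cases
    case 1
    then obtain z where "N = {z}"
      using card_1_singletonE by blast
    then show ?thesis
      using assms by auto
  next
    case 2
    then obtain z w where "N = {z, w}" "z \<noteq> w"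
      by (meson card_2_iff)
    then show ?thesis
      using assms(2)[of z] assms(2)[of w] assms(3) by fastforce
  qed
qed

text \<open>The colors will be enumerated by a map from the model colors to the diagram, opposite to
  the direction required of an isomorphism. Both maps are therefore accepted in that direction and
  inverted.\<close>

lemma colored_poset_iso_of_inverse:
  assumes f: "bij_betw f P2 P1" and h: "bij_betw h \<Gamma>2 \<Gamma>1"
    and ord: "\<And>i j. \<lbrakk>i \<in> P2; j \<in> P2\<rbrakk> \<Longrightarrow> (f i, f j) \<in> r1 \<longleftrightarrow> (i, j) \<in> r2"
    and th: "\<And>s t. \<lbrakk>s \<in> \<Gamma>2; t \<in> \<Gamma>2\<rbrakk> \<Longrightarrow> \<theta>1 (h s) (h t) = \<theta>2 s t"
    and col: "\<And>i. i \<in> P2 \<Longrightarrow> \<kappa>2 i \<in> \<Gamma>2 \<and> \<kappa>1 (f i) = h (\<kappa>2 i)"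
  shows "colored_poset_iso \<Gamma>1 \<theta>1 P1 r1 \<kappa>1 \<Gamma>2 \<theta>2 P2 r2 \<kappa>2 (inv_into P2 f) (inv_into \<Gamma>2 h)"
  unfolding colored_poset_iso_def
proof (intro conjI ballI bij_betw_inv_into f h)
  have f': "inv_into P2 f x \<in> P2" "f (inv_into P2 f x) = x" if "x \<in> P1" for x
    using that f by (auto simp: bij_betw_def inv_into_into f_inv_into_f)
  fix x assume x: "x \<in> P1"
  show "\<kappa>2 (inv_into P2 f x) = inv_into \<Gamma>2 h (\<kappa>1 x)"
    using col[OF f'(1)[OF x]] f'(2)[OF x] h by (metis bij_betw_inv_into_left)
  fix y assume y: "y \<in> P1"
  show "((x, y) \<in> r1) = ((inv_into P2 f x, inv_into P2 f y) \<in> r2)"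
    using ord[OF f'(1)[OF x] f'(1)[OF y]] f'(2)[OF x] f'(2)[OF y] by simp
next
  have h': "inv_into \<Gamma>2 h x \<in> \<Gamma>2" "h (inv_into \<Gamma>2 h x) = x" if "x \<in> \<Gamma>1" for x
    using that h by (auto simp: bij_betw_def inv_into_into f_inv_into_f)
  fix a b assume a: "a \<in> \<Gamma>1" and b: "b \<in> \<Gamma>1"
  show "\<theta>2 (inv_into \<Gamma>2 h a) (inv_into \<Gamma>2 h b) = \<theta>1 a b"
    using th[OF h'(1)[OF a] h'(1)[OF b]] h'(2)[OF a] h'(2)[OF b] by simp
qed

section \<open>Finite minuscule posets and order reversal\<close>

locale finite_minuscule_poset = minuscule_poset \<Gamma> \<theta> P r \<kappa>
  for \<Gamma> :: "'c set" and \<theta> :: "'c \<Rightarrow> 'c \<Rightarrow> int"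
    and P :: "'p set" and r :: "('p \<times> 'p) set" and \<kappa> :: "'p \<Rightarrow> 'c" +
  assumes finite_P: "finite P"
begin

abbreviation lt (infix \<open>\<prec>\<close> 50) where "x \<prec> y \<equiv> strict_below r x y"
abbreviation adj (infix \<open>\<sim>\<close> 50) where "a \<sim> b \<equiv> adjacent \<theta> a b"
abbreviation "is_top \<equiv> maximal_of_color P r \<kappa>"
abbreviation "is_bot \<equiv> minimal_of_color P r \<kappa>"
abbreviation "gap \<equiv> open_interval r"
abbreviation "consec \<equiv> consecutive r \<kappa>"

lemma lt_in: assumes "x \<prec> y" shows "x \<in> P" "y \<in> P"
  using assms poset unfolding strict_below_def partial_order_on_def preorder_on_def by auto

lemma lt_trans: "\<lbrakk>x \<prec> y; y \<prec> z\<rbrakk> \<Longrightarrow> x \<prec> z"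
  using poset unfolding strict_below_def partial_order_on_def preorder_on_def
  by (metis antisymD transD)

lemma lt_irrefl [simp]: "\<not> x \<prec> x"
  unfolding strict_below_def by simp

lemma lt_asym: "x \<prec> y \<Longrightarrow> \<not> y \<prec> x"
  using lt_trans lt_irrefl by blast

lemma le_iff: "x \<in> P \<Longrightarrow> (x, y) \<in> r \<longleftrightarrow> x = y \<or> x \<prec> y"
  using poset unfolding strict_below_def partial_order_on_def preorder_on_def refl_on_def by auto

lemma in_gap [simp]: "z \<in> gap x y \<longleftrightarrow> x \<prec> z \<and> z \<prec> y"
  unfolding open_interval_def by simp

lemma color_in: "x \<in> P \<Longrightarrow> \<kappa> x \<in> \<Gamma>"
  using surj_coloring by blast

lemma finite_sub: "A \<subseteq> P \<Longrightarrow> finite A"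
  using finite_P finite_subset by blast

lemma finite_gap: "finite (gap x y)"
  by (rule finite_sub) (auto dest: lt_in)

lemma same_color_total: "\<lbrakk>x \<in> P; y \<in> P; \<kappa> x = \<kappa> y; x \<noteq> y\<rbrakk> \<Longrightarrow> x \<prec> y \<or> y \<prec> x"
  using EC unfolding comparable_def strict_below_def by metis

lemma adj_total: "\<lbrakk>x \<in> P; y \<in> P; \<kappa> x \<sim> \<kappa> y\<rbrakk> \<Longrightarrow> x \<prec> y \<or> y \<prec> x"
  using AC[of x y] unfolding comparable_def strict_below_def adjacent_def by blast

lemma adj_sym: "\<lbrakk>a \<in> \<Gamma>; b \<in> \<Gamma>; a \<sim> b\<rbrakk> \<Longrightarrow> b \<sim> a"
  using theta_zero_iff[of a b] theta_nonpos[of b a] unfolding adjacent_def by force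

lemma adj_irrefl [simp]: "\<not> a \<sim> a"
  unfolding adjacent_def by simp

lemma adj_weight: "a \<sim> b \<Longrightarrow> 1 \<le> - \<theta> a b"
  unfolding adjacent_def by simp

lemma is_topD: "is_top a x \<Longrightarrow> x \<in> P" "is_top a x \<Longrightarrow> \<kappa> x = a"
  "\<lbrakk>is_top a x; \<kappa> y = a\<rbrakk> \<Longrightarrow> \<not> x \<prec> y"
  "\<lbrakk>is_top a x; y \<in> P; \<kappa> y = a\<rbrakk> \<Longrightarrow> y = x \<or> y \<prec> x"
  using same_color_total[of x y] unfolding maximal_of_color_def by (auto dest: lt_in)

lemma is_botD: "is_bot a x \<Longrightarrow> x \<in> P" "is_bot a x \<Longrightarrow> \<kappa> x = a"
  "\<lbrakk>is_bot a x; \<kappa> y = a\<rbrakk> \<Longrightarrow> \<not> y \<prec> x"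
  "\<lbrakk>is_bot a x; y \<in> P; \<kappa> y = a\<rbrakk> \<Longrightarrow> y = x \<or> x \<prec> y"
  using same_color_total[of x y] unfolding minimal_of_color_def by (auto dest: lt_in)

lemma consecD: "consec a x y \<Longrightarrow> x \<prec> y" "consec a x y \<Longrightarrow> \<kappa> x = a" "consec a x y \<Longrightarrow> \<kappa> y = a"
  "\<lbrakk>consec a x y; x \<prec> z; z \<prec> y\<rbrakk> \<Longrightarrow> \<kappa> z \<noteq> a"
  "consec a x y \<Longrightarrow> x \<in> P" "consec a x y \<Longrightarrow> y \<in> P"
  unfolding consecutive_def by (auto dest: lt_in)

lemma finite_has_maximal:
  assumes "A \<subseteq> P" "A \<noteq> {}" shows "\<exists>x\<in>A. \<forall>y\<in>A. \<not> x \<prec> y"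
  using Finite_Set.bex_max_element[of A "strict_below r"] finite_sub[OF assms(1)] assms(2)
    lt_asym lt_trans lt_irrefl
  by (metis asymp_onI transp_onI)

lemma top_exists: assumes "a \<in> \<Gamma>" shows "\<exists>x. is_top a x"
  using finite_has_maximal[of "{x \<in> P. \<kappa> x = a}"] assms surj_coloring
  unfolding maximal_of_color_def by auto

lemma strict_below_converse [simp]: "strict_below (r\<inverse>) x y \<longleftrightarrow> y \<prec> x"
  unfolding strict_below_def by auto

lemma open_interval_converse [simp]: "open_interval (r\<inverse>) x y = gap y x"
  unfolding open_interval_def by auto

lemma maximal_of_color_converse [simp]: "maximal_of_color P (r\<inverse>) \<kappa> = is_bot"
  by (intro ext) (simp add: minimal_of_color_def maximal_of_color_def)

lemma minimal_of_color_converse [simp]: "minimal_of_color P (r\<inverse>) \<kappa> = is_top"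
  by (intro ext) (simp add: minimal_of_color_def maximal_of_color_def)

lemma consecutive_converse [simp]: "consecutive (r\<inverse>) \<kappa> a x y \<longleftrightarrow> consec a y x"
  unfolding consecutive_def by auto

text \<open>Reversal exchanges UCB1 with LCB1 and preserves the other axioms; NA turns around by the
  symmetry of adjacency. Facts about top elements thereby yield facts about bottom elements.\<close>

lemma dual: "finite_minuscule_poset \<Gamma> \<theta> P (r\<inverse>) \<kappa>"
proof unfold_locales
  show "partial_order_on P (r\<inverse>)"
    using poset by (simp add: partial_order_on_def preorder_on_def refl_on_def) blast
  show "\<kappa> ` P = \<Gamma>" by (rule surj_coloring)
  show "finite P" by (rule finite_P)
  fix x y
  have ci: "closed_interval (r\<inverse>) x y = closed_interval r y x"
    unfolding closed_interval_def by auto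
  show "x \<in> P \<Longrightarrow> y \<in> P \<Longrightarrow> finite (closed_interval (r\<inverse>) x y)"
    unfolding ci by (rule locally_finite)
  show "x \<in> P \<Longrightarrow> y \<in> P \<Longrightarrow> \<kappa> x = \<kappa> y \<Longrightarrow> comparable (r\<inverse>) x y"
    using EC[of x y] unfolding comparable_def by auto
  show "x \<in> P \<Longrightarrow> y \<in> P \<Longrightarrow> \<kappa> x \<sim> \<kappa> y \<Longrightarrow> comparable (r\<inverse>) x y"
    using AC[of x y] unfolding comparable_def by auto
  show "\<kappa> x \<sim> \<kappa> y" if "(x, y) \<in> cover_rel (r\<inverse>)"
  proof -
    have c: "(y, x) \<in> cover_rel r"
      using that unfolding cover_rel_def by simp
    then have "y \<prec> x"
      unfolding cover_rel_def by simp
    then show ?thesis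
      using NA[OF c] adj_sym color_in lt_in by blast
  qed
next
  fix a x y assume "a \<in> \<Gamma>" "consecutive (r\<inverse>) \<kappa> a x y"
  then show "(\<Sum>z\<in>open_interval (r\<inverse>) x y. - \<theta> (\<kappa> z) a) = 2"
    using ICE2[of a y x] by simp
next
  fix a x
  have "upper_adj \<theta> (r\<inverse>) \<kappa> x = lower_adj \<theta> r \<kappa> x" "lower_adj \<theta> (r\<inverse>) \<kappa> x = upper_adj \<theta> r \<kappa> x"
    unfolding upper_adj_def lower_adj_def by auto
  then show "a \<in> \<Gamma> \<Longrightarrow> maximal_of_color P (r\<inverse>) \<kappa> a x \<Longrightarrow> finite (upper_adj \<theta> (r\<inverse>) \<kappa> x)
      \<and> (\<Sum>y\<in>upper_adj \<theta> (r\<inverse>) \<kappa> x. - \<theta> (\<kappa> y) a) \<le> 1"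
    and "a \<in> \<Gamma> \<Longrightarrow> minimal_of_color P (r\<inverse>) \<kappa> a x \<Longrightarrow> finite (lower_adj \<theta> (r\<inverse>) \<kappa> x)
      \<and> (\<Sum>y\<in>lower_adj \<theta> (r\<inverse>) \<kappa> x. - \<theta> (\<kappa> y) a) \<le> 1"
    using LCB1[of a x] UCB1[of a x] by simp_all
qed

lemma bot_exists: assumes "a \<in> \<Gamma>" shows "\<exists>x. is_bot a x"
  using finite_minuscule_poset.top_exists[OF dual assms] by simp

section \<open>Neighbors beyond extreme elements and between consecutive ones\<close>

text \<open>Each neighbor above a top element contributes an integer at least 1 to a sum that UCB1
  bounds by 1. So there is room for only one, and its weight is exactly 1.\<close>

lemma top_adj:
  assumes "is_top a x" "x \<prec> y" "\<kappa> y \<sim> a"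
  shows "\<theta> (\<kappa> y) a = -1" and "\<lbrakk>x \<prec> z; \<kappa> z \<sim> a\<rbrakk> \<Longrightarrow> z = y"
proof -
  let ?U = "upper_adj \<theta> r \<kappa> x"
  have x: "x \<in> P" "\<kappa> x = a" using assms is_topD by auto
  have fin: "finite ?U" and sum: "(\<Sum>y\<in>?U. - \<theta> (\<kappa> y) a) \<le> 1"
    using UCB1[of a x] assms(1) x color_in by auto
  have mem: "w \<in> ?U \<longleftrightarrow> x \<prec> w \<and> \<kappa> w \<sim> a" for w
    unfolding upper_adj_def using x by simp
  have pos: "1 \<le> - \<theta> (\<kappa> w) a" if "w \<in> ?U" for w
    using that adj_weight mem by blast
  have le: "(\<Sum>y\<in>A. - \<theta> (\<kappa> y) a) \<le> 1" if "A \<subseteq> ?U" for A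
    using sum_mono2[OF fin that, of "\<lambda>y. - \<theta> (\<kappa> y) a"] pos sum by force
  show "\<theta> (\<kappa> y) a = -1"
    using le[of "{y}"] pos[of y] mem assms by simp
  show "z = y" if "x \<prec> z" "\<kappa> z \<sim> a"
  proof (rule ccontr)
    assume "z \<noteq> y"
    then show False
      using le[of "{y, z}"] pos[of y] pos[of z] mem assms that by simp
  qed
qed

lemma bot_adj:
  assumes "is_bot a x" "y \<prec> x" "\<kappa> y \<sim> a"
  shows "\<theta> (\<kappa> y) a = -1" and "\<lbrakk>z \<prec> x; \<kappa> z \<sim> a\<rbrakk> \<Longrightarrow> z = y"
  using finite_minuscule_poset.top_adj(1)[OF dual, of a x y]
    finite_minuscule_poset.top_adj(2)[OF dual, of a x y z] assms by simp_all

definition "gap_adj a x y = {z \<in> gap x y. \<kappa> z \<sim> a}"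

lemma in_gap_adj [simp]: "z \<in> gap_adj a x y \<longleftrightarrow> x \<prec> z \<and> z \<prec> y \<and> \<kappa> z \<sim> a"
  unfolding gap_adj_def by simp

lemma finite_gap_adj: "finite (gap_adj a x y)"
  by (rule finite_subset[OF _ finite_gap[of x y]]) auto

text \<open>The color \<open>a\<close> does not occur in the open interval and colors not adjacent
  to \<open>a\<close> have weight 0, so the ICE2 sum lives on \<open>gap_adj\<close>. It is a sum of
  integers at least 1 with value 2, hence 2 or 1 + 1.\<close>

lemma gap_cases:
  assumes "consec a x y"
  shows "(\<exists>z. gap_adj a x y = {z} \<and> \<theta> (\<kappa> z) a = -2) \<or>
    (\<exists>z w. z \<noteq> w \<and> gap_adj a x y = {z, w} \<and> \<theta> (\<kappa> z) a = -1 \<and> \<theta> (\<kappa> w) a = -1)"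
proof -
  have a: "a \<in> \<Gamma>" using consecD[OF assms] color_in by blast
  have "(\<Sum>z\<in>gap_adj a x y. - \<theta> (\<kappa> z) a) = (\<Sum>z\<in>gap x y. - \<theta> (\<kappa> z) a)"
  proof (rule sum.mono_neutral_left)
    show "\<forall>z\<in>gap x y - gap_adj a x y. - \<theta> (\<kappa> z) a = 0"
    proof
      fix z assume z: "z \<in> gap x y - gap_adj a x y"
      then have "\<kappa> z \<noteq> a" "\<kappa> z \<in> \<Gamma>"
        using consecD(4)[OF assms] color_in lt_in by auto
      then show "- \<theta> (\<kappa> z) a = 0"
        using z theta_nonpos[of "\<kappa> z" a] a by (auto simp: adjacent_def)
    qed
  qed (auto simp: finite_gap)
  also have "\<dots> = 2" by (rule ICE2[OF a assms])
  finally have "(\<Sum>z\<in>gap_adj a x y. - \<theta> (\<kappa> z) a) = 2" .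
  then have "(\<exists>z. gap_adj a x y = {z} \<and> - \<theta> (\<kappa> z) a = 2) \<or>
    (\<exists>z w. z \<noteq> w \<and> gap_adj a x y = {z, w} \<and> - \<theta> (\<kappa> z) a = 1 \<and> - \<theta> (\<kappa> w) a = 1)"
    by (intro int_weights_sum_2 finite_gap_adj) (auto dest: adj_weight)
  then show ?thesis
    by (simp only: minus_equation_iff[of "\<theta> _ _"] eq_commute[of "- _" "\<theta> _ _"])
qed

lemma gap_nonempty: "consec a x y \<Longrightarrow> \<exists>z. x \<prec> z \<and> z \<prec> y \<and> \<kappa> z \<sim> a"
  using gap_cases[of a x y] by (auto simp: set_eq_iff)

lemma gap_double:
  assumes "consec a x y" "x \<prec> z" "z \<prec> y" "\<theta> (\<kappa> z) a \<le> -2"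
  shows "\<theta> (\<kappa> z) a = -2" and "\<lbrakk>x \<prec> w; w \<prec> y; \<kappa> w \<sim> a\<rbrakk> \<Longrightarrow> w = z"
proof -
  have "\<kappa> z \<noteq> a" using consecD(4)[OF assms(1-3)] .
  then have "\<kappa> z \<sim> a" using assms(4) by (simp add: adjacent_def)
  then have z: "z \<in> gap_adj a x y" using assms by simp
  have "\<theta> (\<kappa> z) a \<noteq> -1" using assms(4) by simp
  then have sub: "\<exists>z'. gap_adj a x y \<subseteq> {z'} \<and> \<theta> (\<kappa> z') a = -2"
    using gap_cases[OF assms(1)]
  proof (elim disjE exE conjE)
    fix u v assume "gap_adj a x y = {u, v}" "\<theta> (\<kappa> u) a = -1" "\<theta> (\<kappa> v) a = -1"
    then show ?thesis using z \<open>\<theta> (\<kappa> z) a \<noteq> -1\<close> by (metis insertE singletonD)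
  qed (metis subset_refl)
  then obtain z' where z': "gap_adj a x y \<subseteq> {z'}" "\<theta> (\<kappa> z') a = -2"
    by (elim exE conjE)
  have zz: "z = z'" using subsetD[OF z'(1) z] by (rule singletonD)
  show "\<theta> (\<kappa> z) a = -2" unfolding zz by (rule z'(2))
  show "w = z" if "x \<prec> w" "w \<prec> y" "\<kappa> w \<sim> a"
  proof -
    have "w \<in> gap_adj a x y" using that by simp
    from subsetD[OF z'(1) this] show ?thesis unfolding zz by (rule singletonD)
  qed
qed

lemma gap_single:
  assumes "consec a x y" "x \<prec> z" "z \<prec> y" "\<kappa> z \<sim> a" "\<theta> (\<kappa> z) a = -1"
  shows "\<exists>w. w \<noteq> z \<and> x \<prec> w \<and> w \<prec> y \<and> \<kappa> w \<sim> a \<and> \<theta> (\<kappa> w) a = -1 \<and>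
    (\<forall>v. x \<prec> v \<and> v \<prec> y \<and> \<kappa> v \<sim> a \<longrightarrow> v = z \<or> v = w)"
proof -
  have z: "z \<in> gap_adj a x y" using assms by simp
  then obtain u v where uv: "u \<noteq> v" "gap_adj a x y = {u, v}" "\<theta> (\<kappa> u) a = -1" "\<theta> (\<kappa> v) a = -1"
    using gap_cases[OF assms(1)] assms(5) z by fastforce
  have mem: "x \<prec> w \<and> w \<prec> y \<and> \<kappa> w \<sim> a \<longleftrightarrow> w = u \<or> w = v" for w
    using uv(2) in_gap_adj by (metis insert_iff singleton_iff)
  then show ?thesis using uv assms by metis
qed

lemma gap_no_three:
  assumes "consec a x y" "card A \<ge> 3" "\<And>z. z \<in> A \<Longrightarrow> x \<prec> z \<and> z \<prec> y \<and> \<kappa> z \<sim> a"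
  shows False
proof -
  have "A \<subseteq> gap_adj a x y" using assms(3) by auto
  moreover have "card (gap_adj a x y) \<le> 2"
    using gap_cases[OF assms(1)] by force
  ultimately show False using assms(2) card_mono[of "gap_adj a x y" A] finite_gap_adj[of a x y] by simp
qed

lemma next_above:
  assumes "x \<prec> y" "\<kappa> x = a" "\<kappa> y = a"
  shows "\<exists>y'. consec a x y' \<and> (y' = y \<or> y' \<prec> y)"
proof -
  let ?A = "{z. x \<prec> z \<and> \<kappa> z = a}"
  interpret d: finite_minuscule_poset \<Gamma> \<theta> P "r\<inverse>" \<kappa> by (rule dual)
  have "?A \<subseteq> P" "?A \<noteq> {}" using assms lt_in by auto
  then obtain y' where y': "x \<prec> y'" "\<kappa> y' = a" "\<forall>z. x \<prec> z \<and> \<kappa> z = a \<longrightarrow> \<not> z \<prec> y'"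
    using d.finite_has_maximal[of ?A] by auto
  moreover have "y' = y \<or> y' \<prec> y"
    using same_color_total[of y' y] y' assms lt_in by metis
  moreover have "consec a x y'"
    using y' assms(2) unfolding consecutive_def by auto
  ultimately show ?thesis by blast
qed

lemma next_below:
  assumes "x \<prec> y" "\<kappa> x = a" "\<kappa> y = a"
  shows "\<exists>x'. consec a x' y \<and> (x' = x \<or> x \<prec> x')"
  using finite_minuscule_poset.next_above[OF dual, of y x a] assms by simp

text \<open>Take for \<open>x'\<close> the highest element of color \<open>a\<close> below
  \<open>z\<close>. The next element of color \<open>a\<close> cannot lie below \<open>z\<close>,
  and AC makes it comparable to \<open>z\<close>.\<close>

lemma gap_around:
  assumes "x \<prec> z" "z \<prec> y" "\<kappa> x = a" "\<kappa> y = a" "\<kappa> z \<sim> a"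
  shows "\<exists>x' y'. consec a x' y' \<and> x' \<prec> z \<and> z \<prec> y'"
proof -
  let ?A = "{w. w \<prec> z \<and> \<kappa> w = a}"
  have "?A \<subseteq> P" "?A \<noteq> {}" using assms lt_in by auto
  then obtain x' where x': "x' \<prec> z" "\<kappa> x' = a" "\<forall>w. w \<prec> z \<and> \<kappa> w = a \<longrightarrow> \<not> x' \<prec> w"
    using finite_has_maximal[of ?A] by auto
  obtain y' where y': "consec a x' y'" "y' = y \<or> y' \<prec> y"
    using next_above[of x' y a] x' assms lt_trans by blast
  have "\<not> y' \<prec> z" using x' consecD[OF y'(1)] by blast
  moreover have "\<kappa> z \<sim> \<kappa> y'" "y' \<in> P" "z \<in> P" using consecD[OF y'(1)] assms lt_in by auto
  ultimately have "z \<prec> y'" using adj_total[of z y'] by blast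
  then show ?thesis using x' y' by blast
qed

lemma consec_unique_left: "\<lbrakk>consec a x y; consec a x' y\<rbrakk> \<Longrightarrow> x = x'"
  using same_color_total[of x x'] consecD by metis

text \<open>Infinite descent: a neighbor color of \<open>a\<close> inside such an interval must also occur above the
  top element of color \<open>a\<close>, hence is unique and occurs twice inside. These two occurrences bound a
  strictly smaller interval of the same kind, because the top interval of their color is filled by
  two elements of color \<open>a\<close>.\<close>

lemma no_gap_disjoint_from_top_gap:
  assumes "consec a x y"
    and "\<And>s t z w. \<lbrakk>consec a s t; is_top a t; s \<prec> z; z \<prec> t; x \<prec> w; w \<prec> y; \<kappa> w \<sim> a\<rbrakk> \<Longrightarrow> \<kappa> z \<noteq> \<kappa> w"
  shows False
  using assms
proof (induction "card (gap x y)" arbitrary: a x y rule: less_induct)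
  case less
  note xy = consecD[OF less.prems(1)]
  have a: "a \<in> \<Gamma>" using xy color_in by blast
  then obtain T where T: "is_top a T" using top_exists by blast
  note TD = is_topD[OF T]
  have above: "\<exists>t. T \<prec> t \<and> \<kappa> t = \<kappa> w" if w: "x \<prec> w" "w \<prec> y" "\<kappa> w \<sim> a" for w
  proof -
    have wP: "w \<in> P" using w lt_in by blast
    then obtain t where t: "is_top (\<kappa> w) t" using top_exists color_in by blast
    note tD = is_topD[OF t]
    have "x \<prec> t" using tD(4)[OF wP] w lt_trans by blast
    have wa: "\<kappa> t \<sim> a" using tD w by simp
    \<comment> \<open>UCB1 for \<open>t\<close> allows a single element of color \<open>a\<close>
      above it. If \<open>t\<close> were below \<open>T\<close>, that element would be
      \<open>T\<close>, and \<open>t\<close> would lie in the top interval, where the hypothesis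
      forbids its color.\<close>
    have "\<not> t \<prec> T"
    proof
      assume "t \<prec> T"
      then obtain s u where su: "consec a s u" "s \<prec> t" "t \<prec> u"
        using gap_around[of x t T a] \<open>x \<prec> t\<close> xy TD wa by blast
      have "u \<noteq> T"
        using less.prems(2)[OF su(1) _ su(2,3) w] T tD by metis
      moreover have "a \<sim> \<kappa> w" using adj_sym a w wP color_in by blast
      ultimately show False
        using top_adj(2)[OF t su(3), of T] \<open>t \<prec> T\<close> consecD[OF su(1)] TD by simp
    qed
    then have "T \<prec> t" using adj_total[of T t] adj_total[of t T] wa tD TD by metis
    then show ?thesis using tD by blast
  qed
  obtain w where w: "x \<prec> w" "w \<prec> y" "\<kappa> w \<sim> a" using gap_nonempty[OF less.prems(1)] by blast
  define d where "d = \<kappa> w"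
  obtain t where t: "T \<prec> t" "\<kappa> t = d" using above[OF w] d_def by blast
  have da: "d \<sim> a" "a \<sim> d" using w adj_sym a color_in lt_in d_def by blast+
  have "\<theta> d a = -1" using top_adj(1)[OF T t(1)] t da by simp
  then obtain w' where w': "w' \<noteq> w" "x \<prec> w'" "w' \<prec> y" "\<kappa> w' \<sim> a"
    and only: "\<forall>v. x \<prec> v \<and> v \<prec> y \<and> \<kappa> v \<sim> a \<longrightarrow> v = w \<or> v = w'"
    using gap_single[OF less.prems(1) w] d_def by blast
  obtain t' where t': "T \<prec> t'" "\<kappa> t' = \<kappa> w'" using above[OF w'(2-4)] by blast
  have "t' = t" using top_adj(2)[OF T t(1) _ t'(1)] t t' da w' by metis
  then have d': "\<kappa> w' = d" using t t' by simp
  obtain lo hi where lh: "lo \<prec> hi" "x \<prec> lo" "hi \<prec> y" "\<kappa> lo = d" "\<kappa> hi = d" "lo \<prec> y"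
    and lh': "{lo, hi} = {w, w'}"
    using same_color_total[of w w'] w w' d' d_def lt_in by (metis insert_commute)
  have con: "consec d lo hi"
    unfolding consecutive_def
  proof (intro conjI ballI notI)
    fix u assume u: "u \<in> gap lo hi" "\<kappa> u = d"
    then have "x \<prec> u" "u \<prec> y" using lh lt_trans in_gap by blast+
    then have "u \<in> {lo, hi}" using only u da lh' by auto
    then show False using u by auto
  qed (use lh in auto)
  have smaller: "card (gap lo hi) < card (gap x y)"
  proof (rule psubset_card_mono[OF finite_gap])
    have "gap lo hi \<subseteq> gap x y"
      using lt_trans[OF lh(2)] lt_trans[OF _ lh(3)] by auto
    moreover have "lo \<in> gap x y" "lo \<notin> gap lo hi" using lh by auto
    ultimately show "gap lo hi \<subset> gap x y" by blast
  qed
  show False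
  proof (rule less.hyps[OF smaller con])
    fix s u z v
    assume su: "consec d s u" "is_top d u" "s \<prec> z" "z \<prec> u" and v: "lo \<prec> v" "v \<prec> hi" "\<kappa> v \<sim> d"
    show "\<kappa> z \<noteq> \<kappa> v"
    proof
      assume zv: "\<kappa> z = \<kappa> v"
      note sD = consecD[OF su(1)]
      have "T \<prec> u" using is_topD(4)[OF su(2) lt_in(2)[OF t(1)] t(2)] t(1) lt_trans by blast
      have "\<not> T \<prec> s" using top_adj(2)[OF T \<open>T \<prec> u\<close>, of s] sD da by auto
      then have "s \<prec> T" using adj_total[of s T] sD TD da by blast
      have "x \<prec> T" using TD(4)[of y] xy lt_trans by blast
      then obtain T0 where T0: "consec a T0 T" "T0 = x \<or> x \<prec> T0" using next_below[of x T a] xy TD by blast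
      note T0D = consecD[OF T0(1)]
      \<comment> \<open>The color \<open>d\<close> occurs between \<open>x\<close> and
        \<open>y\<close>, so the hypothesis keeps \<open>s\<close> out of the top interval of color
        \<open>a\<close>.\<close>
      have "\<not> T0 \<prec> s" using less.prems(2)[OF T0(1) T _ \<open>s \<prec> T\<close> w] sD d_def by blast
      then have "s \<prec> T0" using adj_total[of s T0] sD T0D da by blast
      have "T0 \<prec> u" using T0D \<open>T \<prec> u\<close> lt_trans by blast
      \<comment> \<open>\<open>T0\<close> and \<open>T\<close> already use up the interval from
        \<open>s\<close> to \<open>u\<close>. The element \<open>z\<close> is a third neighbor,
        because its color occurs strictly between \<open>x\<close> and \<open>y\<close> and so is
        not \<open>a\<close>.\<close>
      have "\<kappa> v \<noteq> a" using xy(4)[of v] v lh lt_trans by blast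
      then have "z \<noteq> T0" "z \<noteq> T" using zv T0D TD by auto
      moreover have "T0 \<noteq> T" using T0D by auto
      ultimately have "card {z, T0, T} \<ge> 3" by simp
      then show False
      proof (rule gap_no_three[OF su(1)])
        fix q assume "q \<in> {z, T0, T}"
        then show "s \<prec> q \<and> q \<prec> u \<and> \<kappa> q \<sim> d"
          using su v zv \<open>s \<prec> T0\<close> \<open>T0 \<prec> u\<close> \<open>s \<prec> T\<close> \<open>T \<prec> u\<close> T0D TD da by auto
      qed
    qed
  qed
qed

subsection \<open>Interlaced colors\<close>

text \<open>The invariant that passes along the path. The conditions on extreme elements make
  \<open>a\<close> occupy the only neighbor place above and below all elements of color
  \<open>b\<close>. The value of \<open>\<theta> b a\<close> is left open, since it is -2 at the
  double bond and -1 afterwards.\<close>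

definition interlaced :: "'c \<Rightarrow> 'c \<Rightarrow> bool" where
  "interlaced a b \<longleftrightarrow> a \<in> \<Gamma> \<and> b \<in> \<Gamma> \<and> a \<sim> b \<and> b \<sim> a \<and> \<theta> a b = -1 \<and>
     (\<forall>x. is_top b x \<longrightarrow> (\<exists>y. x \<prec> y \<and> \<kappa> y = a)) \<and>
     (\<forall>x. is_bot b x \<longrightarrow> (\<exists>y. y \<prec> x \<and> \<kappa> y = a)) \<and>
     (\<forall>x y. consec b x y \<longrightarrow> (\<exists>!z. x \<prec> z \<and> z \<prec> y \<and> \<kappa> z = a))"

lemma interlacedD:
  assumes "interlaced a b"
  shows "a \<in> \<Gamma>" "b \<in> \<Gamma>" "a \<sim> b" "b \<sim> a" "\<theta> a b = -1"
    "is_top b x \<Longrightarrow> \<exists>y. x \<prec> y \<and> \<kappa> y = a"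
    "is_bot b x \<Longrightarrow> \<exists>y. y \<prec> x \<and> \<kappa> y = a"
    "consec b x y \<Longrightarrow> \<exists>!z. x \<prec> z \<and> z \<prec> y \<and> \<kappa> z = a"
  using assms unfolding interlaced_def by blast+

lemma double_bond_between:
  assumes "a \<in> \<Gamma>" "b \<in> \<Gamma>" "\<theta> b a \<le> -2" "z \<in> P" "\<kappa> z = b"
  shows "\<exists>x y. consec a x y \<and> x \<prec> z \<and> z \<prec> y"
proof -
  have "b \<noteq> a" using assms theta_diag[of a] by auto
  then have ba: "b \<sim> a" using assms unfolding adjacent_def by simp
  obtain T B where T: "is_top a T" and B: "is_bot a B"
    using top_exists bot_exists assms by blast
  have "\<not> T \<prec> z" using top_adj(1)[OF T, of z] assms ba by auto
  moreover have "\<not> z \<prec> B" using bot_adj(1)[OF B, of z] assms ba by auto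
  ultimately have "z \<prec> T" "B \<prec> z"
    using adj_total[of z T] adj_total[of z B] assms ba is_topD[OF T] is_botD[OF B] by auto
  then show ?thesis using gap_around[of B z T a] is_topD[OF T] is_botD[OF B] assms ba by auto
qed

text \<open>The interval around the top element of color \<open>b\<close> has no other neighbor of
  \<open>a\<close> in it, and it is the top interval of \<open>a\<close>, because UCB1 permits only
  one element of color \<open>a\<close> above that element. An interval of \<open>a\<close> without
  \<open>b\<close> would therefore share no neighbor color with the top one, which the descent
  excludes.\<close>

lemma double_bond:
  assumes "a \<in> \<Gamma>" "b \<in> \<Gamma>" "\<theta> b a \<le> -2"
  shows "\<theta> b a = -2" and "interlaced a b" and "consec a x y \<Longrightarrow> \<exists>z. x \<prec> z \<and> z \<prec> y \<and> \<kappa> z = b"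
proof -
  note between = double_bond_between[OF assms]
  have "b \<noteq> a" using assms theta_diag[of a] by auto
  then have ba: "b \<sim> a" using assms unfolding adjacent_def by simp
  then have ab: "a \<sim> b" using adj_sym assms by blast
  obtain t where t: "is_top b t" using top_exists assms by blast
  note tD = is_topD[OF t]
  obtain s u where su: "consec a s u" "s \<prec> t" "t \<prec> u" using between[OF tD(1,2)] by blast
  then show "\<theta> b a = -2" using gap_double(1)[OF su] tD assms by simp
  have theta: "\<theta> a b = -1" using top_adj(1)[OF t su(3)] consecD[OF su(1)] ab by simp
  have gaps: "\<exists>z. x \<prec> z \<and> z \<prec> y \<and> \<kappa> z = b" if xy: "consec a x y" for x y
  proof (rule ccontr)
    assume no_b: "\<nexists>z. x \<prec> z \<and> z \<prec> y \<and> \<kappa> z = b"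
    show False
    proof (rule no_gap_disjoint_from_top_gap[OF xy])
      fix s' u' z w
      assume *: "consec a s' u'" "is_top a u'" "s' \<prec> z" "z \<prec> u'" "x \<prec> w" "w \<prec> y" "\<kappa> w \<sim> a"
      have "u \<prec> u' \<or> u = u'" using is_topD(4)[OF *(2), of u] consecD[OF su(1)] by blast
      then have "u = u'"
        using top_adj(2)[OF t su(3), of u'] su(3) lt_trans ab consecD[OF su(1)] consecD[OF *(1)] by metis
      then have "s = s'" using consec_unique_left su *(1) by blast
      show "\<kappa> z \<noteq> \<kappa> w"
      proof
        assume "\<kappa> z = \<kappa> w"
        then have "z = t"
          using gap_double(2)[OF su, of z] * \<open>u = u'\<close> \<open>s = s'\<close> tD assms by simp
        then show False using no_b * tD \<open>\<kappa> z = \<kappa> w\<close> by metis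
      qed
    qed
  qed
  show "consec a x y \<Longrightarrow> \<exists>z. x \<prec> z \<and> z \<prec> y \<and> \<kappa> z = b" by (rule gaps)
  show "interlaced a b"
    unfolding interlaced_def
  proof (intro conjI allI impI assms ab ba theta)
    fix x assume "is_top b x"
    then show "\<exists>y. x \<prec> y \<and> \<kappa> y = a" using between[of x] is_topD[of b x] consecD(3) by blast
  next
    fix x assume "is_bot b x"
    then show "\<exists>y. y \<prec> x \<and> \<kappa> y = a" using between[of x] is_botD[of b x] consecD(2) by blast
  next
    fix x y assume xy: "consec b x y"
    note xyD = consecD[OF xy]
    obtain x1 x2 where x12: "consec a x1 x2" "x1 \<prec> x" "x \<prec> x2" using between[of x] xyD by blast
    note x12D = consecD[OF x12(1)]
    have "\<not> y \<prec> x2"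
    proof
      assume "y \<prec> x2"
      then have "y = x"
        using gap_double(2)[OF x12, of y] xyD assms ba lt_trans[OF x12(2) xyD(1)] by simp
      then show False using xyD by simp
    qed
    then have "x2 \<prec> y" using adj_total[of x2 y] xyD(3,6) x12D(3,6) ab by metis
    moreover have "z = x2" if z: "x \<prec> z" "z \<prec> y" "\<kappa> z = a" for z
    proof -
      \<comment> \<open>Two elements of color \<open>a\<close> between \<open>x\<close> and
        \<open>y\<close> would enclose an interval of \<open>a\<close>, and with it a further
        element of color \<open>b\<close>.\<close>
      have no: False if pq: "p \<prec> q" "x \<prec> p" "q \<prec> y" "\<kappa> p = a" "\<kappa> q = a" for p q
      proof -
        obtain q' where q': "consec a p q'" "q' = q \<or> q' \<prec> q" using next_above[OF pq(1,4,5)] by metis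
        then obtain v where v: "p \<prec> v" "v \<prec> q'" "\<kappa> v = b" using gaps by blast
        have "q' \<prec> y" using q'(2) pq(3) lt_trans by blast
        then show False using xyD(4)[OF lt_trans[OF pq(2) v(1)] lt_trans[OF v(2)]] v(3) by blast
      qed
      show ?thesis
        using same_color_total[of z x2] no[of z x2] no[of x2 z] z x12(3) x12D(3,6) \<open>x2 \<prec> y\<close> lt_in(1)[OF z(2)]
        by metis
    qed
    ultimately show "\<exists>!z. x \<prec> z \<and> z \<prec> y \<and> \<kappa> z = a" using x12 x12D by metis
  qed
qed

section \<open>Propagation and counting of interlaced colors\<close>

text \<open>The only neighbor above \<open>T\<close> and the only one below \<open>B\<close> have
  color \<open>a\<close>, so AC leaves just the space between \<open>B\<close> and
  \<open>T\<close>.\<close>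

lemma interlaced_other_between:
  assumes "interlaced a b" "is_top b T" "is_bot b B" "w \<in> P" "\<kappa> w \<sim> b" "\<kappa> w \<noteq> a"
  shows "w \<prec> T" "B \<prec> w"
proof -
  note ab = interlacedD[OF assms(1)]
  obtain p q where pq: "T \<prec> p" "\<kappa> p = a" "q \<prec> B" "\<kappa> q = a"
    using ab assms by blast
  have "\<not> T \<prec> w" using top_adj(2)[OF assms(2) pq(1), of w] pq ab assms by auto
  moreover have "\<not> w \<prec> B" using bot_adj(2)[OF assms(3) pq(3), of w] pq ab assms by auto
  ultimately show "w \<prec> T" "B \<prec> w"
    using adj_total[of w T] adj_total[of w B] assms is_topD[OF assms(2)] is_botD[OF assms(3)] by auto
qed

text \<open>Each interval of \<open>b\<close> contains one element of color \<open>a\<close>, of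
  weight 1, and so has room for exactly one more neighbor. The top element of every further neighbor
  color lies in the top interval of \<open>b\<close>, hence there is only one such color.\<close>

lemma interlaced_step:
  assumes ab: "interlaced a b" and d: "d \<in> \<Gamma>" "d \<sim> b" "d \<noteq> a"
  shows "\<theta> d b = -1" and "interlaced b d" and "\<lbrakk>e \<in> \<Gamma>; e \<sim> b\<rbrakk> \<Longrightarrow> e = a \<or> e = d"
proof -
  note abD = interlacedD[OF ab]
  obtain T B where T: "is_top b T" and B: "is_bot b B" using top_exists[OF abD(2)] bot_exists[OF abD(2)] by blast
  note TD = is_topD[OF T] and BD = is_botD[OF B]
  note btw = interlaced_other_between[OF ab T B]
  have bd: "b \<sim> d" using adj_sym[OF d(1) abD(2) d(2)] by blast
  \<comment> \<open>UCB1 for \<open>t\<close> leaves room for a single element of color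
    \<open>b\<close> above it. This must be \<open>T\<close>, so no other element of color
    \<open>b\<close> separates \<open>t\<close> from \<open>T\<close>.\<close>
  have in_top_gap: "\<exists>x. consec b x T \<and> x \<prec> t"
    if t: "is_top c t" and c: "c \<in> \<Gamma>" "c \<sim> b" "c \<noteq> a" for c t
  proof -
    note tD = is_topD[OF t]
    have *: "t \<prec> T" "B \<prec> t" using btw[of t] tD c by auto
    then obtain x y where xy: "consec b x y" "x \<prec> t" "t \<prec> y"
      using gap_around[of B t T b] TD BD tD c by auto
    have "b \<sim> c" using adj_sym[OF c(1) abD(2) c(2)] by blast
    then have "y = T" using top_adj(2)[OF t *(1), of y] TD consecD[OF xy(1)] xy by simp
    then show ?thesis using xy by blast
  qed
  obtain t where t: "is_top d t" using top_exists d by blast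
  note tD = is_topD[OF t]
  obtain x where x: "consec b x T" "x \<prec> t" using in_top_gap[OF t d] by blast
  have tT: "t \<prec> T" using btw[of t] tD d by auto
  obtain z where z: "x \<prec> z" "z \<prec> T" "\<kappa> z = a" using abD(8)[OF x(1)] by blast
  have za: "\<kappa> z \<sim> b" "\<theta> (\<kappa> z) b = -1" using z abD(3,5) by auto
  obtain w where w: "\<theta> (\<kappa> w) b = -1"
    and only: "\<forall>v. x \<prec> v \<and> v \<prec> T \<and> \<kappa> v \<sim> b \<longrightarrow> v = z \<or> v = w"
    using gap_single[OF x(1) z(1,2) za] by blast
  have "t = w" using only x tT tD d z by metis
  then show "\<theta> d b = -1" using w tD by simp
  have nb: "e = a \<or> e = d" if e: "e \<in> \<Gamma>" "e \<sim> b" for e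
  proof (rule ccontr)
    assume ne: "\<not> ?thesis"
    obtain v where v: "is_top e v" using top_exists e by blast
    note vD = is_topD[OF v]
    obtain x' where x': "consec b x' T" "x' \<prec> v" using in_top_gap[OF v e] ne by blast
    then have "x' = x" using consec_unique_left x by blast
    moreover have "v \<prec> T" using btw[of v] vD e ne by auto
    ultimately have "v = z \<or> v = w" using only x' vD e by auto
    then show False using ne vD z tD \<open>t = w\<close> by auto
  qed
  then show "\<lbrakk>e \<in> \<Gamma>; e \<sim> b\<rbrakk> \<Longrightarrow> e = a \<or> e = d" .
  have theta: "\<theta> b d = -1" using top_adj(1)[OF t tT] TD bd by simp
  show "interlaced b d"
    unfolding interlaced_def
  proof (intro conjI allI impI abD(2) d(1,2) bd theta)
    fix p assume "is_top d p"
    then show "\<exists>y. p \<prec> y \<and> \<kappa> y = b" using btw(1)[of p] is_topD[of d p] d TD by auto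
  next
    fix p assume "is_bot d p"
    then show "\<exists>y. y \<prec> p \<and> \<kappa> y = b" using btw(2)[of p] is_botD[of d p] d BD by auto
  next
    fix p q assume pq: "consec d p q"
    note pqD = consecD[OF pq]
    have p: "p \<prec> T" "B \<prec> p" and q: "q \<prec> T" "B \<prec> q"
      using btw[of p] btw[of q] pqD d by auto
    obtain x1 x2 where x12: "consec b x1 x2" "x1 \<prec> p" "p \<prec> x2"
      using gap_around[of B p T b] p TD BD pqD d by auto
    note x12D = consecD[OF x12(1)]
    have "\<not> q \<prec> x2"
    proof
      assume "q \<prec> x2"
      obtain v where v: "x1 \<prec> v" "v \<prec> x2" "\<kappa> v = a" using abD(8)[OF x12(1)] by blast
      have "card {v, p, q} \<ge> 3"
        using v pqD d lt_irrefl by (metis One_nat_def card.empty card_insert_disjoint empty_iff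
            finite.emptyI finite.insertI insert_iff numeral_3_eq_3 order_refl)
      then show False
      proof (rule gap_no_three[OF x12(1)])
        fix u assume "u \<in> {v, p, q}"
        then show "x1 \<prec> u \<and> u \<prec> x2 \<and> \<kappa> u \<sim> b"
          using v x12 pqD d \<open>q \<prec> x2\<close> lt_trans[OF x12(2) pqD(1)] abD(3) by auto
      qed
    qed
    then have "x2 \<prec> q" using adj_total[of x2 q] pqD(3,6) x12D(3,6) bd by metis
    moreover have "v = x2" if v: "p \<prec> v" "v \<prec> q" "\<kappa> v = b" for v
    proof -
      have no: False if gh: "g \<prec> h" "p \<prec> g" "h \<prec> q" "\<kappa> g = b" "\<kappa> h = b" for g h
      proof -
        obtain h' where h': "consec b g h'" "h' = h \<or> h' \<prec> h" using next_above[OF gh(1,4,5)] by metis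
        obtain u where u: "g \<prec> u" "u \<prec> h'" "\<kappa> u = a"
          and u1: "\<And>u'. g \<prec> u' \<Longrightarrow> u' \<prec> h' \<Longrightarrow> \<kappa> u' = a \<Longrightarrow> u' = u" using abD(8)[OF h'(1)] by blast
        have "\<kappa> u \<sim> b" "\<theta> (\<kappa> u) b = -1" using u abD(3,5) by auto
        then obtain k where k: "k \<noteq> u" "g \<prec> k" "k \<prec> h'" "\<kappa> k \<sim> b"
          using gap_single[OF h'(1) u(1,2)] by blast
        \<comment> \<open>Besides its single element of color \<open>a\<close>, every interval of
          \<open>b\<close> contains an element of the only other neighbor color \<open>d\<close>.
          Such an interval therefore cannot fit between the consecutive elements \<open>p\<close>
          and \<open>q\<close>.\<close>
        have "\<kappa> k = d" using nb[of "\<kappa> k"] k u1[of k] color_in lt_in by blast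
        moreover have "h' \<prec> q" using h'(2) gh(3) lt_trans by blast
        ultimately show False
          using pqD(4)[OF lt_trans[OF gh(2) k(2)] lt_trans[OF k(3)]] by blast
      qed
      show ?thesis
        using same_color_total[of v x2] no[of v x2] no[of x2 v] v x12(3) x12D(3,6) \<open>x2 \<prec> q\<close> lt_in(1)[OF v(2)]
        by metis
    qed
    ultimately show "\<exists>!v. p \<prec> v \<and> v \<prec> q \<and> \<kappa> v = b" using x12 x12D by metis
  qed
qed

text \<open>Induction downward along the elements of color \<open>b\<close>. Above the top one there
  is exactly one element of color \<open>a\<close>, which accounts for \<open>Suc\<close>; each step
  down passes one element of either color.\<close>

lemma interlaced_card_above:
  assumes ab: "interlaced a b" and x: "x \<in> P" "\<kappa> x = b"
  shows "card {y. x \<prec> y \<and> \<kappa> y = a} = Suc (card {y. x \<prec> y \<and> \<kappa> y = b})"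
proof -
  note abD = interlacedD[OF ab]
  have fin: "finite {y. x \<prec> y \<and> \<kappa> y = c}" for x c by (rule finite_sub) (auto dest: lt_in)
  show ?thesis
    using x
  proof (induction "card {y. x \<prec> y \<and> \<kappa> y = b}" arbitrary: x)
    case 0
    then have e: "{y. x \<prec> y \<and> \<kappa> y = b} = {}" using fin card_0_eq by metis
    then have T: "is_top b x" using 0(2,3) unfolding maximal_of_color_def by auto
    obtain y where y: "x \<prec> y" "\<kappa> y = a" using abD(6)[OF T] by blast
    have "w = y" if "x \<prec> w" "\<kappa> w = a" for w
      using top_adj(2)[OF T y(1) _ that(1)] that(2) y(2) abD(3) by metis
    with y have s: "{y. x \<prec> y \<and> \<kappa> y = a} = {y}" by blast
    show ?case unfolding e s by simp
  next
    case (Suc n)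
    have "{y. x \<prec> y \<and> \<kappa> y = b} \<noteq> {}" using Suc(2) by (metis card.empty nat.distinct(1))
    then obtain v where v: "x \<prec> v" "\<kappa> v = b" by blast
    obtain y where y: "consec b x y" using next_above[OF v(1) Suc(4) v(2)] by blast
    note yD = consecD[OF y]
    have "z = y \<or> y \<prec> z" if "x \<prec> z" "\<kappa> z = b" for z
      using same_color_total[of y z] yD(3,6) yD(4)[of z] lt_in(2)[OF that(1)] that by metis
    then have "{z. x \<prec> z \<and> \<kappa> z = b} = insert y {z. y \<prec> z \<and> \<kappa> z = b}"
      using yD(1,3) lt_trans[OF yD(1)] by (intro equalityI subsetI) auto
    then have n: "card {z. x \<prec> z \<and> \<kappa> z = b} = Suc (card {z. y \<prec> z \<and> \<kappa> z = b})"
      using card_insert_disjoint[OF fin, of y y b] lt_irrefl by simp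
    obtain u where u: "x \<prec> u" "u \<prec> y" "\<kappa> u = a"
      and u1: "\<And>u'. x \<prec> u' \<Longrightarrow> u' \<prec> y \<Longrightarrow> \<kappa> u' = a \<Longrightarrow> u' = u" using abD(8)[OF y] by blast
    have "z = u \<or> y \<prec> z" if "x \<prec> z" "\<kappa> z = a" for z
      using adj_total[of y z] u1[of z] yD(3,6) lt_in(2)[OF that(1)] that abD(4) by metis
    then have "{z. x \<prec> z \<and> \<kappa> z = a} = insert u {z. y \<prec> z \<and> \<kappa> z = a}"
      using u(1,3) lt_trans[OF yD(1)] by (intro equalityI subsetI) auto
    then have a: "card {z. x \<prec> z \<and> \<kappa> z = a} = Suc (card {z. y \<prec> z \<and> \<kappa> z = a})"
      using card_insert_disjoint[OF fin, of u y a] lt_asym[OF u(2)] by simp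
    have "n = card {z. y \<prec> z \<and> \<kappa> z = b}" using Suc(2) n by linarith
    from Suc(1)[OF this yD(6) yD(3)] show ?case unfolding n a by (rule arg_cong)
  qed
qed

text \<open>Elements of a further neighbor color lie strictly between the bottom and the top element
  of \<open>b\<close>, so these differ. Conversely, the single element of color \<open>a\<close> in
  an interval of \<open>b\<close> has weight 1, and the missing weight needs another color. The path
  thus ends exactly at a color with one element.\<close>

lemma interlaced_leaf_iff:
  assumes ab: "interlaced a b"
  shows "(\<exists>d\<in>\<Gamma>. d \<sim> b \<and> d \<noteq> a) \<longleftrightarrow> (\<exists>x y. consec b x y)"
proof
  note abD = interlacedD[OF ab]
  assume "\<exists>d\<in>\<Gamma>. d \<sim> b \<and> d \<noteq> a"
  then obtain w where w: "w \<in> P" "\<kappa> w \<sim> b" "\<kappa> w \<noteq> a" using surj_coloring by blast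
  obtain T B where T: "is_top b T" and B: "is_bot b B"
    using top_exists[OF abD(2)] bot_exists[OF abD(2)] by blast
  have "B \<prec> T" using interlaced_other_between[OF ab T B w] lt_trans by blast
  then show "\<exists>x y. consec b x y" using next_above[of B T b] is_topD(2)[OF T] is_botD(2)[OF B] by blast
next
  note abD = interlacedD[OF ab]
  assume "\<exists>x y. consec b x y"
  then obtain x y where xy: "consec b x y" by blast
  obtain z where z: "x \<prec> z" "z \<prec> y" "\<kappa> z = a"
    and z1: "\<And>v. x \<prec> v \<Longrightarrow> v \<prec> y \<Longrightarrow> \<kappa> v = a \<Longrightarrow> v = z" using abD(8)[OF xy] by blast
  have "\<kappa> z \<sim> b" "\<theta> (\<kappa> z) b = -1" using z abD(3,5) by auto
  then obtain w where w: "w \<noteq> z" "x \<prec> w" "w \<prec> y" "\<kappa> w \<sim> b" using gap_single[OF xy z(1,2)] by blast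
  then have "\<kappa> w \<noteq> a" using z1[of w] by blast
  then show "\<exists>d\<in>\<Gamma>. d \<sim> b \<and> d \<noteq> a" using w(4) color_in[OF lt_in(1)[OF w(3)]] by blast
qed

text \<open>Two elements of color \<open>b\<close> force three of color \<open>a\<close>. In every
  interval of \<open>a\<close> the weight is used up by a single \<open>b\<close>, so
  \<open>d\<close> occurs only above or below all elements of color \<open>a\<close>. UCB1 and LCB1
  for the extreme elements of \<open>d\<close> put it on both sides, and an interval of
  \<open>d\<close> then contains all of color \<open>a\<close>, too many for ICE2.\<close>

lemma double_bond_leaf:
  assumes ba: "a \<in> \<Gamma>" "b \<in> \<Gamma>" "\<theta> b a \<le> -2" and xy: "consec b x y" and d: "d \<in> \<Gamma>" "d \<sim> a"
  shows "d = b"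
proof (rule ccontr)
  assume "d \<noteq> b"
  note xyD = consecD[OF xy]
  note abD = interlacedD[OF double_bond(2)[OF ba]]
  have ad: "a \<sim> d" using adj_sym d ba(1) by blast
  obtain p q where pq: "consec a p q" "p \<prec> x" "x \<prec> q"
    using double_bond_between[OF ba xyD(5,2)] by blast
  obtain p' q' where pq': "consec a p' q'" "p' \<prec> y" "y \<prec> q'"
    using double_bond_between[OF ba xyD(6,3)] by blast
  note pqD = consecD[OF pq(1)] and pqD' = consecD[OF pq'(1)]
  have "\<not> y \<prec> q"
    using gap_double(2)[OF pq, of y] lt_trans[OF pq(2) xyD(1)] xyD(1,2,3) ba(3) abD(4) lt_irrefl by metis
  then have "q \<prec> y" using adj_total[of q y] pqD(3,6) xyD(3,6) abD(3) by metis
  then have qq': "q \<prec> q'" using pq'(3) lt_trans by blast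
  have pq3: "card {p, q, q'} \<ge> 3"
    using lt_irrefl pqD(1) qq' lt_trans[OF pqD(1) qq'] by (auto simp: card_insert_if)
  obtain T B where T: "is_top a T" and B: "is_bot a B" using top_exists bot_exists ba(1) by blast
  have d_out: "T \<prec> w \<or> w \<prec> B" if w: "w \<in> P" "\<kappa> w = d" for w
  proof (rule ccontr)
    assume "\<not> ?thesis"
    then have "w \<prec> T" "B \<prec> w"
      using adj_total[of w T] adj_total[of w B] w d is_topD[OF T] is_botD[OF B] by metis+
    then obtain s t where st: "consec a s t" "s \<prec> w" "w \<prec> t"
      using gap_around[of B w T a] is_topD(2)[OF T] is_botD(2)[OF B] w d by metis
    obtain v where v: "s \<prec> v" "v \<prec> t" "\<kappa> v = b" using double_bond(3)[OF ba st(1)] by blast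
    have "w = v" using gap_double(2)[OF st(1) v(1,2), of w] v(3) ba(3) st(2,3) w d by metis
    then show False using v(3) w \<open>d \<noteq> b\<close> by simp
  qed
  obtain t s where t: "is_top d t" and s: "is_bot d s" using top_exists bot_exists d(1) by blast
  have "B = p \<or> B \<prec> p" using is_botD(4)[OF B pqD(5,2)] by auto
  then have "\<not> t \<prec> B"
    using top_adj(2)[OF t, of p q] lt_trans pqD(1-3) ad lt_irrefl by metis
  then have Tt: "T \<prec> t" using d_out is_topD[OF t] by blast
  have "T = q \<or> q \<prec> T" using is_topD(4)[OF T pqD(6,3)] by auto
  then have "\<not> T \<prec> s"
    using bot_adj(2)[OF s, of q p] lt_trans pqD(1-3) ad lt_irrefl by metis
  then have sB: "s \<prec> B" using d_out is_botD[OF s] by blast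
  have "s \<prec> t" using is_topD(4)[OF T is_botD(1,2)[OF B]] sB Tt lt_trans by metis
  then obtain s' where s': "consec d s s'" using next_above[of s t d] is_topD(2)[OF t] is_botD(2)[OF s] by blast
  note sD = consecD[OF s']
  \<comment> \<open>LCB1 allows only \<open>s\<close> below \<open>B\<close>, so the next element of
    color \<open>d\<close> is already above \<open>T\<close>.\<close>
  have "\<not> s' \<prec> B" using bot_adj(2)[OF B sB, of s'] sD(1-3) d lt_irrefl by metis
  then have Ts: "T \<prec> s'" using d_out[OF sD(6,3)] by blast
  show False
  proof (rule gap_no_three[OF s' pq3])
    fix z assume "z \<in> {p, q, q'}"
    then have z: "\<kappa> z = a" "z \<in> P" using pqD pqD' by auto
    have "s \<prec> z" using is_botD(4)[OF B z(2,1)] sB lt_trans by metis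
    moreover have "z \<prec> s'" using is_topD(4)[OF T z(2,1)] Ts lt_trans by metis
    ultimately show "s \<prec> z \<and> z \<prec> s' \<and> \<kappa> z \<sim> d" using z ad by simp
  qed
qed

subsection \<open>Enclosing colors\<close>

text \<open>Here \<open>l\<close> and \<open>u\<close> are all the elements of color
  \<open>q\<close>; they are distinct, as all of color \<open>p\<close> lies strictly between them.
  The last clause pushes further neighbor colors of \<open>q\<close> outside, the opposite of what
  \<open>interlaced\<close> does.\<close>

definition encloses :: "'c \<Rightarrow> 'c \<Rightarrow> bool" where
  "encloses p q \<longleftrightarrow> p \<in> \<Gamma> \<and> q \<in> \<Gamma> \<and> p \<sim> q \<and> q \<sim> p \<and>
     (\<exists>l u l' u'. is_bot q l \<and> is_top q u \<and> is_bot p l' \<and> is_top p u' \<and> l \<prec> l' \<and> u' \<prec> u \<and>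
       (\<forall>z\<in>P. \<kappa> z = q \<longrightarrow> z = l \<or> z = u) \<and> (\<forall>z. l \<prec> z \<and> z \<prec> u \<and> \<kappa> z \<sim> q \<longrightarrow> \<kappa> z = p))"

text \<open>Elements of color \<open>d\<close> lie above \<open>u\<close> or below \<open>l\<close>,
  with room for one on each side. Both places are taken: a top element of \<open>d\<close> below
  \<open>l\<close> would have \<open>l\<close> and \<open>u\<close> above it, against UCB1, and
  dually. Then \<open>l\<close> and \<open>u\<close> lie in the interval of \<open>d\<close> and
  exhaust it with weight 1 each.\<close>

lemma encloses_step:
  assumes pq: "encloses p q" and d: "d \<in> \<Gamma>" "d \<sim> q" "d \<noteq> p"
  shows "\<theta> d q = -1" and "\<theta> q d = -1" and "encloses q d" and "\<lbrakk>e \<in> \<Gamma>; e \<sim> q\<rbrakk> \<Longrightarrow> e = p \<or> e = d"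
proof -
  obtain l u l' u' where q: "q \<in> \<Gamma>" and l: "is_bot q l" and u: "is_top q u"
    and l': "is_bot p l'" "l \<prec> l'" and u': "is_top p u'" "u' \<prec> u"
    and cls: "\<And>z. z \<in> P \<Longrightarrow> \<kappa> z = q \<Longrightarrow> z = l \<or> z = u"
    and mid: "\<And>z. l \<prec> z \<Longrightarrow> z \<prec> u \<Longrightarrow> \<kappa> z \<sim> q \<Longrightarrow> \<kappa> z = p"
    using pq unfolding encloses_def by blast
  note lD = is_botD[OF l] and uD = is_topD[OF u]
  have "l' = u' \<or> l' \<prec> u'" using is_topD(4)[OF u'(1) is_botD(1,2)[OF l'(1)]] by blast
  then have lu: "l \<prec> u" using l'(2) u'(2) lt_trans by metis
  have out: "u \<prec> w \<or> w \<prec> l" if "w \<in> P" "\<kappa> w \<sim> q" "\<kappa> w \<noteq> p" for w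
    using adj_total[of w u] adj_total[of w l] mid[of w] that uD(1,2) lD(1,2) by metis
  have above: "\<exists>t. is_top e t \<and> u \<prec> t" if e: "e \<in> \<Gamma>" "e \<sim> q" "e \<noteq> p" for e
  proof -
    obtain t where t: "is_top e t" using top_exists e by blast
    have "\<not> t \<prec> l"
      using top_adj(2)[OF t, of l u] lu lt_trans uD(2) lD(2) adj_sym[OF e(1) q e(2)] lt_irrefl by metis
    then show ?thesis using out[of t] is_topD(1,2)[OF t] e t by metis
  qed
  have below: "\<exists>t. is_bot e t \<and> t \<prec> l" if e: "e \<in> \<Gamma>" "e \<sim> q" "e \<noteq> p" for e
  proof -
    obtain t where t: "is_bot e t" using bot_exists e by blast
    have "\<not> u \<prec> t"
      using bot_adj(2)[OF t, of l u] lu lt_trans uD(2) lD(2) adj_sym[OF e(1) q e(2)] lt_irrefl by metis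
    then show ?thesis using out[of t] is_botD(1,2)[OF t] e t by metis
  qed
  obtain s t where t: "is_top d t" "u \<prec> t" and s: "is_bot d s" "s \<prec> l"
    using above[OF d] below[OF d] by blast
  note tD = is_topD[OF t(1)] and sD = is_botD[OF s(1)]
  show "\<theta> d q = -1" using top_adj(1)[OF u t(2)] tD(2) d(2) by simp
  show "\<lbrakk>e \<in> \<Gamma>; e \<sim> q\<rbrakk> \<Longrightarrow> e = p \<or> e = d"
    using above[of e] top_adj(2)[OF u t(2)] tD(2) d(2) is_topD(2) by metis
  have cls_d: "w = s \<or> w = t" if "w \<in> P" "\<kappa> w = d" for w
    using out[of w] top_adj(2)[OF u t(2), of w] bot_adj(2)[OF l s(2), of w] that d(2,3) tD(2) sD(2) by metis
  have st: "s \<prec> t" using s(2) lu t(2) lt_trans by blast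
  have con: "consec d s t"
    unfolding consecutive_def
  proof (intro conjI st tD sD ballI)
    fix z assume "z \<in> gap s t"
    then have "s \<prec> z" "z \<prec> t" by auto
    then show "\<kappa> z \<noteq> d" using cls_d[of z] lt_irrefl lt_in(2)[of s z] by metis
  qed
  have qd: "q \<sim> d" using adj_sym[OF d(1) q d(2)] .
  have lg: "s \<prec> l" "l \<prec> t" "s \<prec> u" "u \<prec> t" using s t lu lt_trans by blast+
  have theta: "\<theta> q d = -1"
  proof (rule ccontr)
    assume "\<theta> q d \<noteq> -1"
    then have "\<theta> q d \<le> -2" using qd unfolding adjacent_def by linarith
    then have "u = l" using gap_double(2)[OF con lg(1,2), of u] lg lD(2) uD(2) qd by simp
    then show False using lu by simp
  qed
  then show "\<theta> q d = -1" .
  have "\<kappa> l \<sim> d" "\<theta> (\<kappa> l) d = -1" using lD(2) qd theta by auto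
  then obtain w where only: "\<forall>v. s \<prec> v \<and> v \<prec> t \<and> \<kappa> v \<sim> d \<longrightarrow> v = l \<or> v = w"
    using gap_single[OF con lg(1,2)] by blast
  then have "u = w" using lg uD(2) qd lu lt_irrefl by metis
  then have "\<forall>z. s \<prec> z \<and> z \<prec> t \<and> \<kappa> z \<sim> d \<longrightarrow> \<kappa> z = q" using only lD(2) uD(2) by metis
  then show "encloses q d"
    unfolding encloses_def using q d qd l u s t cls_d by blast
qed

text \<open>UCB1 and LCB1 for the only element of color \<open>b\<close> leave one element of color
  \<open>a\<close> on each side of it, and its weight 2 leaves no other neighbor between these
  two.\<close>

lemma double_bond_encloses:
  assumes ba: "a \<in> \<Gamma>" "b \<in> \<Gamma>" "\<theta> b a \<le> -2" and no: "\<nexists>x y. consec b x y"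
  shows "encloses b a" and "is_top b z \<Longrightarrow> is_bot b z"
proof -
  note abD = interlacedD[OF double_bond(2)[OF ba]]
  have bot: "is_bot b z" if "is_top b z" for z
    using no next_above[of _ z b] is_topD[OF that] unfolding minimal_of_color_def by metis
  then show "is_top b z \<Longrightarrow> is_bot b z" .
  obtain z where T: "is_top b z" using top_exists ba by blast
  note B = bot[OF T]
  note zD = is_topD[OF T]
  obtain u l where u: "z \<prec> u" "\<kappa> u = a" and l: "l \<prec> z" "\<kappa> l = a"
    using abD(6)[OF T] abD(7)[OF B] by blast
  have cls: "w = l \<or> w = u" if w: "w \<in> P" "\<kappa> w = a" for w
    using adj_total[of w z] top_adj(2)[OF T u(1), of w] bot_adj(2)[OF B l(1), of w] w u(2) l(2) abD(3) zD(1,2)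
    by metis
  have lu: "l \<prec> u" using l u lt_trans by blast
  have "is_top a u" "is_bot a l"
    unfolding maximal_of_color_def minimal_of_color_def using cls lt_in lu u(2) l(2) lt_asym lt_irrefl by metis+
  moreover have con: "consec a l u"
    unfolding consecutive_def
  proof (intro conjI lu u l ballI)
    fix v assume "v \<in> gap l u"
    then have "l \<prec> v" "v \<prec> u" by auto
    then show "\<kappa> v \<noteq> a" using cls[of v] lt_irrefl lt_in(2)[of l v] by metis
  qed
  moreover have "\<forall>v. l \<prec> v \<and> v \<prec> u \<and> \<kappa> v \<sim> a \<longrightarrow> \<kappa> v = b"
    using gap_double(2)[OF con l(1) u(1)] zD(2) ba(3) by metis
  ultimately show "encloses b a"
    unfolding encloses_def using ba abD(3,4) T B u(1) l(1) cls by blast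
qed

subsection \<open>The Dynkin diagram as a path\<close>

text \<open>By NA a step in the Hasse diagram moves to an adjacent color, so connectedness of the
  poset passes to the Dynkin diagram.\<close>

lemma connected_closed:
  assumes "connected_poset P r" "A \<subseteq> \<Gamma>" "A \<noteq> {}"
    and closed: "\<And>c e. \<lbrakk>c \<in> A; e \<in> \<Gamma>; e \<sim> c\<rbrakk> \<Longrightarrow> e \<in> A"
  shows "A = \<Gamma>"
proof -
  obtain x where x: "x \<in> P" "\<kappa> x \<in> A" using assms(2,3) surj_coloring by blast
  have "\<kappa> y \<in> A" if y: "y \<in> P" for y
  proof -
    have "(x, y) \<in> (cover_rel r \<union> (cover_rel r)\<inverse>)\<^sup>*"
      using assms(1) x y unfolding connected_poset_def by blast
    then show ?thesis
    proof (induction rule: rtrancl_induct)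
      case base
      then show ?case using x by simp
    next
      case (step y z)
      then have "\<kappa> y \<sim> \<kappa> z \<or> \<kappa> z \<sim> \<kappa> y" using NA by blast
      moreover have "y \<prec> z \<or> z \<prec> y" using step(2) unfolding cover_rel_def by blast
      then have "\<kappa> y \<in> \<Gamma>" "\<kappa> z \<in> \<Gamma>" using color_in lt_in by blast+
      ultimately show ?case using closed[OF step(3)] adj_sym by blast
    qed
  qed
  then show ?thesis using assms(2) surj_coloring by blast
qed

text \<open>The measure \<open>\<mu>\<close> rules out cycles and makes the sequence of colors end.\<close>

lemma color_path:
  assumes conn: "connected_poset P r"
    and S: "\<And>a b. S a b \<Longrightarrow> a \<in> \<Gamma> \<and> b \<in> \<Gamma> \<and> \<mu> b < (\<mu> a :: nat)"
    and step: "\<And>a b d. \<lbrakk>S a b; d \<in> \<Gamma>; d \<sim> b; d \<noteq> a\<rbrakk> \<Longrightarrow> S b d"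
    and unique: "\<And>a b d e. \<lbrakk>S a b; d \<in> \<Gamma>; d \<sim> b; d \<noteq> a; e \<in> \<Gamma>; e \<sim> b\<rbrakk> \<Longrightarrow> e = a \<or> e = d"
    and ab: "S a b" and leaf: "\<And>e. e \<in> \<Gamma> \<Longrightarrow> e \<sim> a \<Longrightarrow> e = b"
  obtains M g where "1 \<le> M" "g 0 = a" "g 1 = b" "bij_betw g {..M} \<Gamma>"
    "\<And>i. i < M \<Longrightarrow> S (g i) (g (Suc i))"
    "\<And>i j. \<lbrakk>i \<le> M; j \<le> M; g i \<sim> g j\<rbrakk> \<Longrightarrow> i = Suc j \<or> j = Suc i"
proof -
  \<comment> \<open>The neighbor condition omits index 0: in the induction step the shorter path
    starts at \<open>b\<close>, which also has the neighbor \<open>a\<close>. For the original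
    start, \<open>leaf\<close> supplies this case afterwards.\<close>
  have "\<exists>M\<ge>1. \<exists>g. g 0 = a \<and> g 1 = b \<and> (\<forall>i<M. S (g i) (g (Suc i))) \<and>
      (\<forall>i. 0 < i \<and> i \<le> M \<longrightarrow> (\<forall>e\<in>\<Gamma>. e \<sim> g i \<longrightarrow> e = g (i - 1) \<or> (i < M \<and> e = g (Suc i))))"
    using ab
  proof (induction "\<mu> b" arbitrary: a b rule: less_induct)
    case less
    show ?case
    proof (cases "\<exists>d\<in>\<Gamma>. d \<sim> b \<and> d \<noteq> a")
      case False
      show ?thesis
      proof (intro exI conjI)
        let ?g = "\<lambda>i::nat. if i = 0 then a else b"
        show "(1::nat) \<le> 1" "?g 0 = a" "?g 1 = b" "\<forall>i<1. S (?g i) (?g (Suc i))" using less.prems by auto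
        show "\<forall>i. 0 < i \<and> i \<le> 1 \<longrightarrow> (\<forall>e\<in>\<Gamma>. e \<sim> ?g i \<longrightarrow> e = ?g (i - 1) \<or> (i < 1 \<and> e = ?g (Suc i)))"
          using False by (metis diff_is_0_eq' neq0_conv)
      qed
    next
      case True
      then obtain d where d: "d \<in> \<Gamma>" "d \<sim> b" "d \<noteq> a" by blast
      note bd = step[OF less.prems d]
      have "\<mu> d < \<mu> b" using S[OF bd] by blast
      from less.hyps[OF this bd] obtain M g where M: "1 \<le> M" and g: "g 0 = b" "g 1 = d"
        and gS: "\<forall>i<M. S (g i) (g (Suc i))"
        and gN: "\<forall>i. 0 < i \<and> i \<le> M \<longrightarrow> (\<forall>e\<in>\<Gamma>. e \<sim> g i \<longrightarrow> e = g (i - 1) \<or> (i < M \<and> e = g (Suc i)))"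
        by blast
      let ?g = "case_nat a g"
      show ?thesis
      proof (intro exI conjI)
        show "1 \<le> Suc M" "?g 0 = a" "?g 1 = b" using g by auto
        show "\<forall>i<Suc M. S (?g i) (?g (Suc i))" using gS g less.prems by (auto split: nat.split)
        show "\<forall>i. 0 < i \<and> i \<le> Suc M \<longrightarrow>
          (\<forall>e\<in>\<Gamma>. e \<sim> ?g i \<longrightarrow> e = ?g (i - 1) \<or> (i < Suc M \<and> e = ?g (Suc i)))"
        proof (intro allI impI ballI)
          fix i e assume i: "0 < i \<and> i \<le> Suc M" and e: "e \<in> \<Gamma>" "e \<sim> ?g i"
          obtain k where k: "i = Suc k" using i by (cases i) auto
          show "e = ?g (i - 1) \<or> (i < Suc M \<and> e = ?g (Suc i))"
          proof (cases k)
            case 0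
            then show ?thesis using unique[OF less.prems d, of e] e k g M by auto
          next
            case (Suc k')
            then show ?thesis using gN[rule_format, of k e] e k i by auto
          qed
        qed
      qed
    qed
  qed
  then obtain M g where M: "1 \<le> M" and g: "g 0 = a" "g 1 = b"
    and gS: "\<forall>i<M. S (g i) (g (Suc i))"
    and gN: "\<forall>i. 0 < i \<and> i \<le> M \<longrightarrow> (\<forall>e\<in>\<Gamma>. e \<sim> g i \<longrightarrow> e = g (i - 1) \<or> (i < M \<and> e = g (Suc i)))"
    by blast
  have gG: "g i \<in> \<Gamma>" if "i \<le> M" for i
  proof (cases i)
    case 0
    then show ?thesis using S[OF ab] g by simp
  next
    case (Suc k)
    then show ?thesis using S[of "g k" "g (Suc k)"] gS that by simp
  qed
  have mu: "\<mu> (g j) < \<mu> (g i)" if "i < j" "j \<le> M" for i j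
    using that
  proof (induction j)
    case (Suc j)
    have "\<mu> (g (Suc j)) < \<mu> (g j)" using S[of "g j" "g (Suc j)"] gS Suc(3) by simp
    then show ?case using Suc by (cases "i = j") auto
  qed simp
  have inj: "inj_on g {..M}"
  proof (rule inj_onI)
    fix i j assume "i \<in> {..M}" "j \<in> {..M}" "g i = g j"
    then show "i = j" using mu[of i j] mu[of j i] by (cases i j rule: linorder_cases) auto
  qed
  have nb: "\<exists>j\<le>M. e = g j \<and> (i = Suc j \<or> j = Suc i)" if ie: "i \<le> M" "e \<in> \<Gamma>" "e \<sim> g i" for i e
  proof (cases "i = 0")
    case True
    then have "e = g 1" using leaf[of e] ie g by simp
    then show ?thesis using M True by (intro exI[of _ 1]) simp
  next
    case False
    then consider "e = g (i - 1)" | "i < M" "e = g (Suc i)"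
      using gN[rule_format, of i e] ie by auto
    then show ?thesis
    proof cases
      case 1
      then show ?thesis using False ie(1) by (intro exI[of _ "i - 1"]) simp
    next
      case 2
      then show ?thesis by (intro exI[of _ "Suc i"]) simp
    qed
  qed
  have "g ` {..M} = \<Gamma>"
  proof (rule connected_closed[OF conn])
    show "g ` {..M} \<subseteq> \<Gamma>" using gG by auto
    show "g ` {..M} \<noteq> {}" by auto
    fix c e assume "c \<in> g ` {..M}" "e \<in> \<Gamma>" "e \<sim> c"
    then obtain i where "i \<le> M" "e \<sim> g i" by auto
    then show "e \<in> g ` {..M}" using nb[of i e] \<open>e \<in> \<Gamma>\<close> by (metis atMost_iff imageI)
  qed
  then have "bij_betw g {..M} \<Gamma>" using inj by (simp add: bij_betw_def)
  moreover have "i = Suc j \<or> j = Suc i" if "i \<le> M" "j \<le> M" "g i \<sim> g j" for i j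
    using nb[OF that(2) gG[OF that(1)] that(3)] inj_onD[OF inj] that(1) by (metis atMost_iff)
  ultimately show thesis using that[OF M g] gS by simp
qed

subsection \<open>Identification with the models\<close>

text \<open>Above the bottom element of color \<open>b\<close> the counts already differ by one.
  That element itself is balanced by the single element of color \<open>a\<close> below it.\<close>

lemma interlaced_card:
  assumes ab: "interlaced a b"
  shows "card {x \<in> P. \<kappa> x = a} = Suc (card {x \<in> P. \<kappa> x = b})"
proof -
  note abD = interlacedD[OF ab]
  have fin: "finite {y. x \<prec> y \<and> \<kappa> y = c}" for x c by (rule finite_sub) (auto dest: lt_in)
  obtain B where B: "is_bot b B" using bot_exists abD by blast
  note BD = is_botD[OF B]
  obtain q where q: "q \<prec> B" "\<kappa> q = a" using abD(7)[OF B] by blast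
  have "z = q \<or> B \<prec> z" if z: "z \<in> P" "\<kappa> z = a" for z
    using bot_adj(2)[OF B q(1), of z] adj_total[of z B] z q(2) BD(1,2) abD(3) by metis
  then have a: "{x \<in> P. \<kappa> x = a} = insert q {y. B \<prec> y \<and> \<kappa> y = a}"
    using q lt_in by blast
  have b: "{x \<in> P. \<kappa> x = b} = insert B {y. B \<prec> y \<and> \<kappa> y = b}"
    using BD(1,2,4) lt_in by blast
  have "card {x \<in> P. \<kappa> x = a} = Suc (card {y. B \<prec> y \<and> \<kappa> y = a})"
    unfolding a using card_insert_disjoint[OF fin, of q B a] lt_asym[OF q(1)] by simp
  moreover have "card {x \<in> P. \<kappa> x = b} = Suc (card {y. B \<prec> y \<and> \<kappa> y = b})"
    unfolding b using card_insert_disjoint[OF fin, of B B b] by simp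
  ultimately show ?thesis using interlaced_card_above[OF ab BD(1,2)] by simp
qed

text \<open>The first coordinate \<open>u\<close> in the type B model; the color index is \<open>v - u\<close>.\<close>

definition rank :: "'p \<Rightarrow> nat" where
  "rank x = card {y. x \<prec> y \<and> \<kappa> y = \<kappa> x}"

lemma rank_less: assumes "x \<prec> y" "\<kappa> x = \<kappa> y" shows "rank y < rank x"
  unfolding rank_def
proof (rule psubset_card_mono)
  show "finite {z. x \<prec> z \<and> \<kappa> z = \<kappa> x}" by (rule finite_sub) (auto dest: lt_in)
  have "{z. y \<prec> z \<and> \<kappa> z = \<kappa> y} \<subseteq> {z. x \<prec> z \<and> \<kappa> z = \<kappa> x}"
    using lt_trans[OF assms(1)] assms(2) by auto
  then show "{z. y \<prec> z \<and> \<kappa> z = \<kappa> y} \<subset> {z. x \<prec> z \<and> \<kappa> z = \<kappa> x}"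
    using assms lt_irrefl by fastforce
qed

lemma rank_inj: "\<lbrakk>x \<in> P; y \<in> P; \<kappa> x = \<kappa> y; rank x = rank y\<rbrakk> \<Longrightarrow> x = y"
  using rank_less same_color_total by (metis less_irrefl)

lemma rank_bound: assumes "x \<in> P" shows "rank x < card {y \<in> P. \<kappa> y = \<kappa> x}"
  unfolding rank_def
proof (rule psubset_card_mono)
  show "finite {y \<in> P. \<kappa> y = \<kappa> x}" by (rule finite_sub) auto
  have "{y. x \<prec> y \<and> \<kappa> y = \<kappa> x} \<subseteq> {y \<in> P. \<kappa> y = \<kappa> x}"
    using lt_in(2) by auto
  moreover have "x \<in> {y \<in> P. \<kappa> y = \<kappa> x}" "x \<notin> {y. x \<prec> y \<and> \<kappa> y = \<kappa> x}"
    using assms by auto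
  ultimately show "{y. x \<prec> y \<and> \<kappa> y = \<kappa> x} \<subset> {y \<in> P. \<kappa> y = \<kappa> x}"
    by blast
qed

text \<open>Ranks within a color are distinct and smaller than the number of its elements, so every
  value is attained.\<close>

lemma rank_surj:
  assumes "k < card {y \<in> P. \<kappa> y = c}"
  shows "\<exists>x\<in>P. \<kappa> x = c \<and> rank x = k"
proof -
  let ?A = "{y \<in> P. \<kappa> y = c}"
  have fin: "finite ?A" by (rule finite_sub) auto
  have "inj_on rank ?A" by (rule inj_onI) (use rank_inj in auto)
  then have "card (rank ` ?A) = card ?A" by (rule card_image)
  moreover have "rank ` ?A \<subseteq> {..<card ?A}" using rank_bound by auto
  ultimately have "rank ` ?A = {..<card ?A}" by (intro card_subset_eq) auto
  then have "k \<in> rank ` ?A" using assms by simp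
  then show ?thesis by blast
qed

text \<open>Exactly \<open>rank y + 1\<close> elements of color \<open>a\<close> lie above
  \<open>y\<close>, namely those of rank at most \<open>rank y\<close>. Equal ranks put
  \<open>x\<close> above \<open>y\<close> because the alternating sequence begins with
  \<open>a\<close> at the top.\<close>

lemma rank_interlaced:
  assumes ab: "interlaced a b" and x: "x \<in> P" "\<kappa> x = a" and y: "y \<in> P" "\<kappa> y = b"
  shows "y \<prec> x \<longleftrightarrow> rank x \<le> rank y" and "x \<prec> y \<longleftrightarrow> rank y < rank x"
proof -
  let ?U = "{z. y \<prec> z \<and> \<kappa> z = a}" and ?V = "{z. x \<prec> z \<and> \<kappa> z = \<kappa> x}"
  have fin: "finite ?U" "finite ?V" by (rule finite_sub; auto dest: lt_in)+
  have U: "card ?U = Suc (rank y)"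
    using interlaced_card_above[OF ab y] y unfolding rank_def by simp
  have total: "x \<prec> y \<or> y \<prec> x" using adj_total[OF x(1) y(1)] interlacedD(3)[OF ab] x(2) y(2) by simp
  have 1: "rank x \<le> rank y" if "y \<prec> x"
  proof -
    have "?V \<subset> ?U" using that x lt_trans[OF that] lt_irrefl by fastforce
    then show ?thesis using psubset_card_mono[OF fin(1), of ?V] U unfolding rank_def by simp
  qed
  have 2: "rank y < rank x" if "x \<prec> y"
  proof -
    have "?U \<subseteq> ?V" using x(2) lt_trans[OF that] by auto
    then show ?thesis using card_mono[OF fin(2), of ?U] U unfolding rank_def by simp
  qed
  show "y \<prec> x \<longleftrightarrow> rank x \<le> rank y" "x \<prec> y \<longleftrightarrow> rank y < rank x"
    using 1 2 total by linarith+
qed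

text \<open>Allows a transitive property to be checked on covers only, where NA makes the colors
  adjacent.\<close>

lemma lt_induct_cover [consumes 1, case_names cover trans]:
  assumes "x \<prec> y"
    and "\<And>x y. (x, y) \<in> cover_rel r \<Longrightarrow> Q x y"
    and "\<And>x y z. \<lbrakk>x \<prec> y; y \<prec> z; Q x y; Q y z\<rbrakk> \<Longrightarrow> Q x z"
  shows "Q x y"
  using assms(1)
proof (induction "card (gap x y)" arbitrary: x y rule: less_induct)
  case less
  show ?case
  proof (cases "gap x y = {}")
    case True
    then show ?thesis using assms(2) less.prems unfolding cover_rel_def by simp
  next
    case False
    then obtain z where z: "x \<prec> z" "z \<prec> y" by auto
    have "gap x z \<subseteq> gap x y" "gap z y \<subseteq> gap x y"
      using lt_trans[OF _ z(2)] lt_trans[OF z(1)] by auto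
    moreover have "z \<in> gap x y" "z \<notin> gap x z" "z \<notin> gap z y" using z by auto
    ultimately have "gap x z \<subset> gap x y" "gap z y \<subset> gap x y" by blast+
    then have "card (gap x z) < card (gap x y)" "card (gap z y) < card (gap x y)"
      using psubset_card_mono[OF finite_gap] by blast+
    then show ?thesis using less.hyps z assms(3) by metis
  qed
qed

section \<open>Type B\<close>

text \<open>The leaf assumption makes \<open>a\<close> the end c_0 of the path, with
  \<open>b\<close> as c_1. The colors have M + 1, M, ..., 1 elements, which is the triangle of the
  model with n = M + 1.\<close>

lemma type_B_if_leaf:
  assumes conn: "connected_poset P r" and ba: "a \<in> \<Gamma>" "b \<in> \<Gamma>" "\<theta> b a \<le> -2"
    and leaf: "\<And>e. e \<in> \<Gamma> \<Longrightarrow> e \<sim> a \<Longrightarrow> e = b"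
  shows "type_B \<Gamma> \<theta> P r \<kappa>"
proof -
  have "\<exists>M g. 1 \<le> M \<and> g 0 = a \<and> g 1 = b \<and> bij_betw g {..M} \<Gamma> \<and>
      (\<forall>i<M. interlaced (g i) (g (Suc i))) \<and>
      (\<forall>i j. i \<le> M \<longrightarrow> j \<le> M \<longrightarrow> g i \<sim> g j \<longrightarrow> i = Suc j \<or> j = Suc i)"
  proof (rule color_path[OF conn, of interlaced "\<lambda>c. card {x \<in> P. \<kappa> x = c}" a b])
    show "\<And>a b. interlaced a b \<Longrightarrow> a \<in> \<Gamma> \<and> b \<in> \<Gamma> \<and> card {x \<in> P. \<kappa> x = b} < card {x \<in> P. \<kappa> x = a}"
      using interlacedD(1,2) interlaced_card by simp
    show "interlaced a b" by (rule double_bond(2)[OF ba])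
  qed (use interlaced_step leaf in \<open>blast+\<close>)
  then obtain M g where M: "1 \<le> M" and g: "g 0 = a" "g 1 = b" and bij: "bij_betw g {..M} \<Gamma>"
    and il: "\<And>i. i < M \<Longrightarrow> interlaced (g i) (g (Suc i))"
    and adj: "\<And>i j. \<lbrakk>i \<le> M; j \<le> M; g i \<sim> g j\<rbrakk> \<Longrightarrow> i = Suc j \<or> j = Suc i"
    by metis
  have gG: "g i \<in> \<Gamma>" if "i \<le> M" for i using bij that bij_betwE by fastforce
  have ginj: "i = j" if "g i = g j" "i \<le> M" "j \<le> M" for i j
    using bij that by (metis atMost_iff bij_betw_inv_into_left)
  have last: "card {x \<in> P. \<kappa> x = g M} = 1"
  proof -
    obtain k where k: "M = Suc k" using M by (cases M) auto
    have il': "interlaced (g k) (g M)" using il k by simp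
    have "\<nexists>d. d \<in> \<Gamma> \<and> d \<sim> g M \<and> d \<noteq> g k"
    proof
      assume "\<exists>d. d \<in> \<Gamma> \<and> d \<sim> g M \<and> d \<noteq> g k"
      then obtain i where "i \<le> M" "g i \<sim> g M" "g i \<noteq> g k"
        using bij unfolding bij_betw_def by (metis atMost_iff imageE)
      then show False using adj[of i M] k by auto
    qed
    then have no: "\<nexists>x y. consec (g M) x y" using interlaced_leaf_iff[OF il'] by blast
    obtain T where T: "is_top (g M) T" using top_exists gG by blast
    have "{x \<in> P. \<kappa> x = g M} = {T}"
      using is_topD[OF T] no next_above[of _ T "g M"] by blast
    then show ?thesis by simp
  qed
  \<comment> \<open>The count runs backwards, since it is the size of the last color that is
    known.\<close>
  have card': "card {x \<in> P. \<kappa> x = g (M - k)} = Suc k" if "k \<le> M" for k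
    using that
  proof (induction k)
    case 0
    then show ?case using last by simp
  next
    case (Suc k)
    then have "Suc (M - Suc k) = M - k" by simp
    then show ?case using interlaced_card[OF il[of "M - Suc k"]] Suc by simp
  qed
  have card: "card {x \<in> P. \<kappa> x = g i} = Suc (M - i)" if "i \<le> M" for i
    using card'[of "M - i"] that by simp
  define lev where "lev x = inv_into {..M} g (\<kappa> x)" for x
  have lev: "lev x \<le> M" "g (lev x) = \<kappa> x" if "x \<in> P" for x
    using color_in[OF that] bij unfolding lev_def bij_betw_def
    by (auto simp: f_inv_into_f)
  have levI: "lev x = i" if "x \<in> P" "\<kappa> x = g i" "i \<le> M" for x i
    using ginj[of "lev x" i] lev[OF that(1)] that by metis
  define pos where "pos x = (int (rank x), int (rank x + lev x))" for x
  have bound: "rank x + lev x \<le> M" if "x \<in> P" for x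
    using rank_bound[OF that] card[OF lev(1)[OF that]] lev[OF that] by simp
  have ex: "\<exists>x\<in>P. rank x = u \<and> lev x = s" if "u + s \<le> M" for u s
    using rank_surj[of u "g s"] card[of s] levI[of _ s] that by (metis add_leD2 le_diff_conv2 less_Suc_eq_le)
  have pos_bij: "bij_betw pos P (B_carrier (Suc M))"
    unfolding bij_betw_def
  proof
    show "inj_on pos P"
    proof (rule inj_onI)
      fix x y assume xy: "x \<in> P" "y \<in> P" "pos x = pos y"
      then have "rank x = rank y" "lev x = lev y" unfolding pos_def by auto
      then show "x = y" using rank_inj[OF xy(1,2)] lev xy by metis
    qed
    show "pos ` P = B_carrier (Suc M)"
    proof
      show "pos ` P \<subseteq> B_carrier (Suc M)"
        unfolding B_carrier_def pos_def using bound by fastforce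
      show "B_carrier (Suc M) \<subseteq> pos ` P"
      proof
        fix p assume p: "p \<in> B_carrier (Suc M)"
        obtain u v where uv: "p = (u, v)" "0 \<le> u" "u \<le> v" "v \<le> int M"
          using p unfolding B_carrier_def by auto
        have "nat u + nat (v - u) \<le> M" using uv by simp
        then obtain x where x: "x \<in> P" "rank x = nat u" "lev x = nat (v - u)" using ex by blast
        then have "pos x = p" using uv unfolding pos_def by simp
        then show "p \<in> pos ` P" using x by blast
      qed
    qed
  qed
  define le where "le x y \<longleftrightarrow> rank y \<le> rank x \<and> rank y + lev y \<le> rank x + lev x" for x y
  have pos_le: "(pos x, pos y) \<in> B_order (Suc M) \<longleftrightarrow> le x y" if "x \<in> P" "y \<in> P" for x y
    using bij_betwE[OF pos_bij] that unfolding B_order_def le_def pos_def by fastforce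
  have up: "x \<prec> y \<longleftrightarrow> rank y < rank x" and down: "y \<prec> x \<longleftrightarrow> rank x \<le> rank y"
    if "x \<in> P" "y \<in> P" "lev y = Suc (lev x)" for x y
    using rank_interlaced[OF il[of "lev x"], of x y] lev[OF that(1)] lev[OF that(2)] that by simp_all
  \<comment> \<open>A cover joins neighboring levels, where comparing ranks decides the
    order.\<close>
  have lt_le: "le x y" if "x \<prec> y" for x y
    using that
  proof (induction rule: lt_induct_cover)
    case (cover x y)
    then have xy: "x \<prec> y" unfolding cover_rel_def by simp
    note P = lt_in[OF xy]
    have "lev x = Suc (lev y) \<or> lev y = Suc (lev x)"
      using adj[of "lev x" "lev y"] NA[OF cover] lev[OF P(1)] lev[OF P(2)] by simp
    then show ?case
      using up[OF P] down[OF P(2,1)] xy unfolding le_def by auto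
  qed (simp add: le_def)
  \<comment> \<open>A walk from \<open>x\<close> up to \<open>y\<close> inside the triangle.
    Lowering the rank by one while raising the level decreases u and keeps v; lowering the level at
    equal rank decreases v and keeps u. Induction is on the sum of the two coordinate
    distances.\<close>
  have le_lt: "x = y \<or> x \<prec> y" if "le x y" "x \<in> P" "y \<in> P" for x y
    using that
  proof (induction "(rank x - rank y) + (rank x + lev x - (rank y + lev y))" arbitrary: x rule: less_induct)
    case less
    note xP = less.prems(2) and yP = less.prems(3)
    consider "rank y < rank x" | "rank y = rank x" "lev y < lev x" | "rank y = rank x" "lev y = lev x"
      using less.prems(1) unfolding le_def by linarith
    then show ?case
    proof cases
      case 1
      then obtain z where z: "z \<in> P" "rank z = rank x - 1" "lev z = Suc (lev x)"
        using ex[of "rank x - 1" "Suc (lev x)"] bound[OF xP] by auto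
      have "x \<prec> z" using up[OF xP z(1,3)] z 1 by simp
      moreover have "z = y \<or> z \<prec> y"
        using less.hyps[of z] z 1 yP less.prems(1) unfolding le_def by simp
      ultimately show ?thesis using lt_trans by metis
    next
      case 2
      have "rank x + (lev x - 1) \<le> M" using bound[OF xP] by simp
      then obtain z where z: "z \<in> P" "rank z = rank x" "lev z = lev x - 1" using ex by blast
      have "x \<prec> z" using down[OF z(1) xP] z 2 by simp
      moreover have "z = y \<or> z \<prec> y"
        using less.hyps[of z] z 2 yP less.prems(1) unfolding le_def by simp
      ultimately show ?thesis using lt_trans by metis
    next
      case 3
      then show ?thesis using rank_inj[OF xP yP] lev(2)[OF xP] lev(2)[OF yP] by metis
    qed
  qed
  have ord: "(x, y) \<in> r \<longleftrightarrow> (pos x, pos y) \<in> B_order (Suc M)" if "x \<in> P" "y \<in> P" for x y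
  proof -
    have "le x x" by (simp add: le_def)
    then show ?thesis using le_iff[OF that(1)] pos_le[OF that] lt_le[of x y] le_lt[OF _ that] by metis
  qed
  have th: "\<theta> (g i) (g j) = B_theta i j" if ij: "i \<le> M" "j \<le> M" for i j
  proof -
    have s1: "\<theta> (g i) (g (Suc i)) = -1" if "i < M" for i using interlacedD(5)[OF il[OF that]] .
    \<comment> \<open>The restriction to positive \<open>i\<close> matters: the entry at index 0 is
      the double bond, of value -2.\<close>
    have s2: "\<theta> (g (Suc i)) (g i) = -1" if i: "i < M" "0 < i" for i
    proof -
      obtain k where k: "i = Suc k" using i by (cases i) auto
      have "interlaced (g k) (g i)" "interlaced (g i) (g (Suc i))" using il i k by auto
      moreover have "g (Suc i) \<noteq> g k" using ginj[of "Suc i" k] k i by auto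
      ultimately show ?thesis using interlaced_step(1) interlacedD(2,4) by metis
    qed
    consider "i = j" | "j = Suc i" | "i = 1" "j = 0" | "i = Suc j" "0 < j" | "\<not> g i \<sim> g j" "i \<noteq> j"
      "j \<noteq> Suc i" "i \<noteq> Suc j"
      using adj[OF ij] by (metis One_nat_def neq0_conv)
    then show ?thesis
    proof cases
      case 1
      then show ?thesis using theta_diag gG ij unfolding B_theta_def by simp
    next
      case 2
      then show ?thesis using s1[of i] ij unfolding B_theta_def by simp
    next
      case 3
      then show ?thesis using double_bond(1)[OF ba] g unfolding B_theta_def by simp
    next
      case 4
      then show ?thesis using s2[of j] ij unfolding B_theta_def by simp
    next
      case 5
      then have "g i \<noteq> g j" using ginj ij by blast
      then have "\<theta> (g i) (g j) = 0"
        using 5 theta_nonpos[OF gG[OF ij(1)] gG[OF ij(2)]] unfolding adjacent_def by linarith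
      then show ?thesis using 5 unfolding B_theta_def by auto
    qed
  qed
  let ?f = "inv_into P pos"
  have f: "?f p \<in> P" "pos (?f p) = p" if "p \<in> B_carrier (Suc M)" for p
    using that pos_bij by (auto simp: bij_betw_def inv_into_into f_inv_into_f)
  have "colored_poset_iso \<Gamma> \<theta> P r \<kappa> (B_colors (Suc M)) B_theta (B_carrier (Suc M)) (B_order (Suc M))
    B_coloring (inv_into (B_carrier (Suc M)) ?f) (inv_into (B_colors (Suc M)) g)"
  proof (rule colored_poset_iso_of_inverse)
    have colors: "B_colors (Suc M) = {..M}" unfolding B_colors_def by auto
    show "bij_betw ?f (B_carrier (Suc M)) P" by (rule bij_betw_inv_into[OF pos_bij])
    show "bij_betw g (B_colors (Suc M)) \<Gamma>" unfolding colors by (rule bij)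
    show "(?f i, ?f j) \<in> r \<longleftrightarrow> (i, j) \<in> B_order (Suc M)"
      if "i \<in> B_carrier (Suc M)" "j \<in> B_carrier (Suc M)" for i j
      using ord[OF f(1)[OF that(1)] f(1)[OF that(2)]] f(2)[OF that(1)] f(2)[OF that(2)] by simp
    show "\<theta> (g s) (g t) = B_theta s t" if "s \<in> B_colors (Suc M)" "t \<in> B_colors (Suc M)" for s t
      using th that unfolding colors by simp
    show "B_coloring i \<in> B_colors (Suc M) \<and> \<kappa> (?f i) = g (B_coloring i)"
      if "i \<in> B_carrier (Suc M)" for i
    proof -
      have "B_coloring (pos (?f i)) = lev (?f i)" unfolding B_coloring_def pos_def by simp
      then have "B_coloring i = lev (?f i)" using f(2)[OF that] by simp
      then show ?thesis using lev[OF f(1)[OF that]] unfolding colors by simp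
    qed
  qed
  then show ?thesis unfolding type_B_def using M by (intro exI[of _ "Suc M"]) auto
qed

section \<open>Type C\<close>

text \<open>The further neighbor \<open>d\<close> of \<open>a\<close> leaves \<open>b\<close> with a
  single element, the middle of the chain, and each later color adds one element at either end. The
  path starts at \<open>b\<close>, so \<open>g i\<close> corresponds to c_{n-i}.\<close>

lemma type_C_if_not_leaf:
  assumes conn: "connected_poset P r" and ba: "a \<in> \<Gamma>" "b \<in> \<Gamma>" "\<theta> b a \<le> -2"
    and d: "d \<in> \<Gamma>" "d \<sim> a" "d \<noteq> b"
  shows "type_C \<Gamma> \<theta> P r \<kappa>"
proof -
  have no: "\<nexists>x y. consec b x y" using double_bond_leaf[OF ba _ d(1,2)] d(3) by blast
  note enc = double_bond_encloses[OF ba no]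
  have leaf: "e = a" if "e \<in> \<Gamma>" "e \<sim> b" for e
    using interlaced_leaf_iff[OF double_bond(2)[OF ba]] no that by blast
  \<comment> \<open>The number of elements above all those of color \<open>c\<close>. Class sizes,
    the measure in type B, fail here because all colors after \<open>b\<close> have two
    elements.\<close>
  define \<mu> where "\<mu> c = card {y \<in> P. \<forall>x\<in>P. \<kappa> x = c \<longrightarrow> x \<prec> y}" for c
  have mu: "\<mu> q < \<mu> p" if pq: "encloses p q" for p q
  proof -
    obtain u u' where u: "is_top q u" "is_top p u'" "u' \<prec> u"
      using pq unfolding encloses_def by blast
    have *: "\<forall>x\<in>P. \<kappa> x = p \<longrightarrow> x \<prec> y" if "u' \<prec> y" for y
      using is_topD(4)[OF u(2)] that lt_trans by metis
    have "u \<notin> {y \<in> P. \<forall>x\<in>P. \<kappa> x = q \<longrightarrow> x \<prec> y}" using is_topD[OF u(1)] lt_irrefl by blast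
    moreover have "u \<in> {y \<in> P. \<forall>x\<in>P. \<kappa> x = p \<longrightarrow> x \<prec> y}" using *[OF u(3)] is_topD[OF u(1)] by blast
    moreover have "{y \<in> P. \<forall>x\<in>P. \<kappa> x = q \<longrightarrow> x \<prec> y} \<subseteq> {y \<in> P. \<forall>x\<in>P. \<kappa> x = p \<longrightarrow> x \<prec> y}"
      using *[OF lt_trans[OF u(3)]] is_topD(1,2)[OF u(1)] by blast
    ultimately show ?thesis
      unfolding \<mu>_def using finite_sub[of "{y \<in> P. \<forall>x\<in>P. \<kappa> x = p \<longrightarrow> x \<prec> y}"]
      by (intro psubset_card_mono) auto
  qed
  have "\<exists>M g. 1 \<le> M \<and> g 0 = b \<and> g 1 = a \<and> bij_betw g {..M} \<Gamma> \<and>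
      (\<forall>i<M. encloses (g i) (g (Suc i))) \<and>
      (\<forall>i j. i \<le> M \<longrightarrow> j \<le> M \<longrightarrow> g i \<sim> g j \<longrightarrow> i = Suc j \<or> j = Suc i)"
  proof (rule color_path[OF conn, of encloses \<mu> b a])
    show "\<And>a b. encloses a b \<Longrightarrow> a \<in> \<Gamma> \<and> b \<in> \<Gamma> \<and> \<mu> b < \<mu> a"
      using mu unfolding encloses_def by blast
    show "encloses b a" by (rule enc(1))
  qed (use encloses_step leaf in \<open>blast+\<close>)
  then obtain M g where M: "1 \<le> M" and g: "g 0 = b" "g 1 = a" and bij: "bij_betw g {..M} \<Gamma>"
    and en: "\<And>i. i < M \<Longrightarrow> encloses (g i) (g (Suc i))"
    and adj: "\<And>i j. \<lbrakk>i \<le> M; j \<le> M; g i \<sim> g j\<rbrakk> \<Longrightarrow> i = Suc j \<or> j = Suc i"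
    by metis
  have gG: "g i \<in> \<Gamma>" if "i \<le> M" for i using bij that bij_betwE by fastforce
  have ginj: "i = j" if "g i = g j" "i \<le> M" "j \<le> M" for i j
    using bij that by (metis atMost_iff bij_betw_inv_into_left)
  have gsurj: "\<exists>i\<le>M. c = g i" if "c \<in> \<Gamma>" for c
    using bij that unfolding bij_betw_def by (metis atMost_iff imageE)
  \<comment> \<open>The color \<open>d\<close> is a third one, which gives the bound 3 on n = M +
    1.\<close>
  have M2: "2 \<le> M"
  proof (rule ccontr)
    assume "\<not> 2 \<le> M"
    then have "M = 1" using M by simp
    then obtain i where "i \<le> 1" "d = g i" using gsurj d by blast
    then have "d = a \<or> d = b" using g by (cases "i = 0") (auto simp: le_Suc_eq)
    then show False using d by auto
  qed
  define U where "U i = (SOME x. is_top (g i) x)" for i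
  define L where "L i = (SOME x. is_bot (g i) x)" for i
  have U: "is_top (g i) (U i)" and L: "is_bot (g i) (L i)" if "i \<le> M" for i
    unfolding U_def L_def using top_exists bot_exists gG[OF that] someI_ex by metis+
  have UI: "x = U i" if "is_top (g i) x" "i \<le> M" for x i
    using is_topD(4)[OF that(1)] is_topD(3)[OF that(1)] is_topD(1,2)[OF U[OF that(2)]]
      is_topD(3)[OF U[OF that(2)]] is_topD(2)[OF that(1)] by metis
  have LI: "x = L i" if "is_bot (g i) x" "i \<le> M" for x i
    using is_botD(4)[OF that(1)] is_botD(3)[OF that(1)] is_botD(1,2)[OF L[OF that(2)]]
      is_botD(3)[OF L[OF that(2)]] is_botD(2)[OF that(1)] by metis
  have UL0: "U 0 = L 0"
    using LI[of 0 "U 0"] enc(2)[of "U 0"] U[of 0] g by simp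
  have step: "U i \<prec> U (Suc i)" "L (Suc i) \<prec> L i" and
    cls: "\<And>z. z \<in> P \<Longrightarrow> \<kappa> z = g (Suc i) \<Longrightarrow> z = L (Suc i) \<or> z = U (Suc i)" if i: "i < M" for i
  proof -
    have i': "i \<le> M" "Suc i \<le> M" using i by auto
    obtain l u l' u' where *: "is_bot (g (Suc i)) l" "is_top (g (Suc i)) u" "is_bot (g i) l'" "is_top (g i) u'"
      "l \<prec> l'" "u' \<prec> u" "\<forall>z\<in>P. \<kappa> z = g (Suc i) \<longrightarrow> z = l \<or> z = u"
      using en[OF i] unfolding encloses_def by blast
    have "l = L (Suc i)" "u = U (Suc i)" "l' = L i" "u' = U i"
      using LI[OF *(1) i'(2)] UI[OF *(2) i'(2)] LI[OF *(3) i'(1)] UI[OF *(4) i'(1)] by auto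
    then show "U i \<prec> U (Suc i)" "L (Suc i) \<prec> L i"
      "\<And>z. z \<in> P \<Longrightarrow> \<kappa> z = g (Suc i) \<Longrightarrow> z = L (Suc i) \<or> z = U (Suc i)"
      using * by auto
  qed
  define n where "n = Suc M"
  \<comment> \<open>Position \<open>j\<close> from the top of the chain. The top elements occupy the
    upper half from \<open>U M\<close> down to the middle \<open>U 0\<close> at
    \<open>j = n\<close>, which equals \<open>L 0\<close>; then \<open>L 1\<close> to
    \<open>L M\<close> follow.\<close>
  define f where "f j = (if j \<le> n then U (n - j) else L (j - n))" for j
  have carrier: "j \<in> C_carrier n \<longleftrightarrow> 1 \<le> j \<and> j \<le> n + M" for j
    unfolding C_carrier_def n_def by auto
  have fP: "f j \<in> P" "\<kappa> (f j) = g (n - C_coloring n j)" "C_coloring n j \<in> C_colors n"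
    if "j \<in> C_carrier n" for j
  proof -
    have j: "1 \<le> j" "j \<le> n + M" using that carrier by auto
    show "C_coloring n j \<in> C_colors n"
      using j unfolding C_coloring_def C_colors_def n_def by auto
    show "f j \<in> P"
      using is_topD(1)[OF U[of "n - j"]] is_botD(1)[OF L[of "j - n"]] j unfolding f_def n_def by auto
    have "n - (2 * n - j) = j - n" if "\<not> j \<le> n" using that j n_def by simp
    then show "\<kappa> (f j) = g (n - C_coloring n j)"
      using is_topD(2)[OF U[of "n - j"]] is_botD(2)[OF L[of "j - n"]] j
      unfolding f_def C_coloring_def n_def by auto
  qed
  have f_Suc: "f (Suc j) \<prec> f j" if "1 \<le> j" "j < n + M" for j
  proof -
    consider "j < n" | "j = n" | "n < j" by linarith
    then show ?thesis
    proof cases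
      case 1
      then have "Suc (n - Suc j) = n - j" by simp
      then show ?thesis using step(1)[of "n - Suc j"] 1 that unfolding f_def n_def by simp
    next
      case 2
      then show ?thesis using step(2)[of 0] M UL0 unfolding f_def by simp
    next
      case 3
      then have "Suc j - n = Suc (j - n)" by simp
      then show ?thesis using step(2)[of "j - n"] 3 that unfolding f_def by simp
    qed
  qed
  have f_mono: "f j \<prec> f i" if "1 \<le> i" "i < j" "j \<le> n + M" for i j
    using that(2,3)
  proof (induction j)
    case (Suc j)
    have *: "f (Suc j) \<prec> f j" using f_Suc[of j] Suc(2,3) that(1) by simp
    show ?case
    proof (cases "i = j")
      case False
      then show ?thesis using Suc lt_trans[OF *] by simp
    qed (use * in simp)
  qed simp
  have f_inj: "inj_on f (C_carrier n)"
  proof (rule inj_onI)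
    fix i j assume "i \<in> C_carrier n" "j \<in> C_carrier n" "f i = f j"
    then show "i = j"
      using f_mono[of i j] f_mono[of j i] carrier lt_irrefl by (metis linorder_neqE_nat)
  qed
  have "P \<subseteq> f ` C_carrier n"
  proof
    fix x assume x: "x \<in> P"
    obtain i where i: "i \<le> M" "\<kappa> x = g i" using gsurj[OF color_in[OF x]] by blast
    have "x = U i \<or> (x = L i \<and> 0 < i)"
    proof (cases i)
      case 0
      have "x = U 0 \<or> x \<prec> U 0" "x = L 0 \<or> L 0 \<prec> x"
        using is_topD(4)[OF U[OF i(1)] x i(2)] is_botD(4)[OF L[OF i(1)] x i(2)] 0 by auto
      then show ?thesis using UL0 lt_asym 0 by metis
    next
      case (Suc k)
      then show ?thesis using cls[of k x] i x by auto
    qed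
    moreover have "f (n - i) = U i" "n - i \<in> C_carrier n" using i(1) unfolding f_def carrier by (auto simp: n_def)
    moreover have "f (n + i) = L i" "n + i \<in> C_carrier n" if "0 < i"
      using that i(1) unfolding f_def carrier by (auto simp: n_def)
    ultimately show "x \<in> f ` C_carrier n" by (metis image_eqI)
  qed
  then have f_bij: "bij_betw f (C_carrier n) P"
    using f_inj fP(1) unfolding bij_betw_def by blast
  have ord: "(f i, f j) \<in> r \<longleftrightarrow> (i, j) \<in> C_order n" if "i \<in> C_carrier n" "j \<in> C_carrier n" for i j
  proof -
    have "(f i, f j) \<in> r \<longleftrightarrow> j \<le> i"
      using le_iff[OF fP(1)[OF that(1)]] f_mono[of i j] f_mono[of j i] lt_asym[of "f i" "f j"]
        inj_onD[OF f_inj _ that] that carrier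
      by (metis le_neq_implies_less lt_irrefl not_le_imp_less order_refl)
    then show ?thesis using that unfolding C_order_def by simp
  qed
  have th: "\<theta> (g i) (g j) = C_theta n (n - i) (n - j)" if ij: "i \<le> M" "j \<le> M" for i j
  proof -
    have s: "\<theta> (g (Suc i)) (g i) = -1" "\<theta> (g i) (g (Suc i)) = -1" if i: "i < M" "0 < i" for i
    proof -
      obtain k where k: "i = Suc k" using i by (cases i) auto
      have "encloses (g k) (g i)" using en i k by auto
      moreover have "g (Suc i) \<in> \<Gamma>" "g (Suc i) \<sim> g i" using en[OF i(1)] unfolding encloses_def by auto
      moreover have "g (Suc i) \<noteq> g k" using ginj[of "Suc i" k] k i by auto
      ultimately show "\<theta> (g (Suc i)) (g i) = -1" "\<theta> (g i) (g (Suc i)) = -1"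
        using encloses_step(1,2) by blast+
    qed
    have 0: "\<theta> (g 0) (g 1) = -2" "\<theta> (g 1) (g 0) = -1"
      using double_bond(1)[OF ba] interlacedD(5)[OF double_bond(2)[OF ba]] g by auto
    \<comment> \<open>In this direction the double bond has value -1 too, so no exception at index 0
      is needed.\<close>
    have up: "\<theta> (g (Suc i)) (g i) = -1" if "i < M" for i
      using s(1)[OF that] 0(2) by (cases "i = 0") auto
    consider "i = j" | "i = 0" "j = 1" | "j = Suc i" "0 < i" | "i = Suc j" | "\<not> g i \<sim> g j" "i \<noteq> j"
      "j \<noteq> Suc i" "i \<noteq> Suc j"
      using adj[OF ij] by (metis One_nat_def neq0_conv)
    then show ?thesis
    proof cases
      case 1
      then show ?thesis using theta_diag gG ij unfolding C_theta_def by simp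
    next
      case 2
      then show ?thesis using 0(1) M unfolding C_theta_def n_def by simp
    next
      case 3
      then show ?thesis using s(2)[of i] ij unfolding C_theta_def n_def by auto
    next
      case 4
      then show ?thesis using up[of j] ij unfolding C_theta_def n_def by auto
    next
      case 5
      then have "g i \<noteq> g j" using ginj ij by blast
      then have "\<theta> (g i) (g j) = 0"
        using 5 theta_nonpos[OF gG[OF ij(1)] gG[OF ij(2)]] unfolding adjacent_def by linarith
      moreover have "n - i \<noteq> n - j" "\<not> (n - i = n \<and> n - j = n - 1)" "n - j \<noteq> Suc (n - i)" "n - i \<noteq> Suc (n - j)"
        using 5 ij M unfolding n_def by auto
      ultimately show ?thesis unfolding C_theta_def by auto
    qed
  qed
  have colors: "bij_betw (\<lambda>c. n - c) (C_colors n) {..M}"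
    by (rule bij_betw_byWitness[where f' = "\<lambda>i. n - i"]) (auto simp: C_colors_def n_def)
  have "colored_poset_iso \<Gamma> \<theta> P r \<kappa> (C_colors n) (C_theta n) (C_carrier n) (C_order n) (C_coloring n)
    (inv_into (C_carrier n) f) (inv_into (C_colors n) (g \<circ> (\<lambda>c. n - c)))"
  proof (rule colored_poset_iso_of_inverse[OF f_bij])
    show "bij_betw (g \<circ> (\<lambda>c. n - c)) (C_colors n) \<Gamma>" by (rule bij_betw_trans[OF colors bij])
    show "(f i, f j) \<in> r \<longleftrightarrow> (i, j) \<in> C_order n" if "i \<in> C_carrier n" "j \<in> C_carrier n" for i j
      by (rule ord[OF that])
    show "\<theta> ((g \<circ> (\<lambda>c. n - c)) s) ((g \<circ> (\<lambda>c. n - c)) t) = C_theta n s t"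
      if "s \<in> C_colors n" "t \<in> C_colors n" for s t
      using th[of "n - s" "n - t"] that unfolding C_colors_def n_def by auto
    show "C_coloring n i \<in> C_colors n \<and> \<kappa> (f i) = (g \<circ> (\<lambda>c. n - c)) (C_coloring n i)"
      if "i \<in> C_carrier n" for i
      using fP[OF that] by simp
  qed
  then show ?thesis unfolding type_C_def using M2 n_def by (intro exI[of _ n]) auto
qed

end

theorem theorem3p7:
  fixes \<Gamma> :: "'c set" and \<theta> :: "'c \<Rightarrow> 'c \<Rightarrow> int"
    and P :: "'p set" and r :: "('p \<times> 'p) set" and \<kappa> :: "'p \<Rightarrow> 'c"
  assumes "minuscule_poset \<Gamma> \<theta> P r \<kappa>"
    and "finite P"
    and "connected_poset P r"
    and "multiply_laced \<Gamma> \<theta>"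
  shows "type_B \<Gamma> \<theta> P r \<kappa> \<or> type_C \<Gamma> \<theta> P r \<kappa>"
proof -
  interpret finite_minuscule_poset \<Gamma> \<theta> P r \<kappa>
    using assms(1,2) by (intro finite_minuscule_poset.intro finite_minuscule_poset_axioms.intro)
  obtain a b where ab: "b \<in> \<Gamma>" "a \<in> \<Gamma>" "\<theta> b a \<notin> {-1, 0, 2}"
    using assms(4) unfolding simply_laced_def by blast
  \<comment> \<open>The diagonal entries are 2 and the others are nonpositive, so an exceptional
    value is at most -2.\<close>
  then have "b \<noteq> a" using theta_diag by auto
  then have "\<theta> b a \<le> 0" using theta_nonpos ab by blast
  then have double: "\<theta> b a \<le> -2" using ab(3) by auto
  show ?thesis
  proof (cases "\<exists>d\<in>\<Gamma>. adjacent \<theta> d a \<and> d \<noteq> b")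
    case True
    then show ?thesis using type_C_if_not_leaf[OF assms(3) ab(2,1) double] by blast
  next
    case False
    then show ?thesis using type_B_if_leaf[OF assms(3) ab(2,1) double] by blast
  qed
qed

end
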